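(* Let $(\lambda_1,\lambda_2)$ be in the unstable regime. Let $u_0\in H$ and $c=\|u_0\|_2^2$. If $$Q(u_0)>0\quad\text{and}\quad E(u_0)<\gamma(c),$$ then the solution $\psi$ of $$i\partial_t\psi=-\tfrac12\Delta\psi+\lambda_1|\psi|^2\psi+\lambda_2(K\star|\psi|^2)\psi,\qquad x\in\mathbb{R}^3,$$ with initial condition $\psi(0)=u_0$ exists globally in time.
   Context: $H=H^1(\mathbb{R}^3,\mathbb{C})$. $f\mapsto K\star f$ is the Fourier multiplier with symbol $\hat K(\xi)=\frac43\pi\,\frac{2\xi_3^2-\xi_1^2-\xi_2^2}{|\xi|^2}$ (convolution with the dipolar kernel $K(x)=\frac{1-3\cos^2\theta}{|x|^3}$, $\theta$ the angle between $x$ and $(0,0,1)$). The pair $(\lambda_1,\lambda_2)\in\mathbb{R}^2$ with $\lambda_2\ne0$ is in the unstable regime if $\lambda_1-\frac43\pi\lambda_2<0$ when $\lambda_2>0$, and $\lambda_1+\frac83\pi\lambda_2<0$ when $\lambda_2<0$. For $u\in H$: $A(u)=\|\nabla u\|_2^2$, $B(u)=\lambda_1\|u\|_4^4+\lambda_2\int_{\mathbb{R}^3}(K\star|u|^2)|u|^2dx$, $E(u)=\frac12A(u)+\frac12B(u)$, $Q(u)=A(u)+\frac32B(u)$; $S(c)=\{u\in H:\|u\|_2^2=c\}$. The mountain pass level is $\gamma(c)=\inf_{g\in\Gamma(c)}\max_{t\in[0,1]}E(g(t))$, where $\Gamma(c)=\{g\in C([0,1],S(c)): g(0)\in A_k,\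 E(g(1))<0\}$, $A_k=\{u\in S(c):\|\nabla u\|_2^2\le k\}$, and $k=k(c)>0$ is a fixed number such that $\gamma(c)>\max\{\sup_{g\in\Gamma(c)}E(g(0)),\sup_{g\in\Gamma(c)}E(g(1))\}$ (such a $k$ exists in the unstable regime). By known local theory, for each initial datum in $H$ there is a unique maximal solution $\psi\in C([0,T_{max});H)$ with $\psi,\nabla\psi\in L^{8/3}_{loc}([0,T_{max});L^4(\mathbb{R}^3))$; it conserves $\|\psi\|_2^2$ and $E(\psi)$, and either $T_{max}=\infty$ or $\|\nabla\psi(t)\|_2\to\infty$ as $t\to T_{max}$. "Exists globally" means $T_{max}=\infty$. *)

theory Defs
  imports "HOL-Analysis.Analysis"
begin

text \<open>
  Elements of \<open>L\<^sup>2(\<real>\<^sup>3)\<close> and \<open>H\<^sup>1(\<real>\<^sup>3)\<close> are represented by Borel functions; two functions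
  that agree almost everywhere stand for the same element. All integrals in space are with
  respect to \<^const>\<open>lborel\<close>.
\<close>

section \<open>Smooth functions and Fourier transform\<close>

definition pdiff :: "3 \<Rightarrow> (real^3 \<Rightarrow> complex) \<Rightarrow> real^3 \<Rightarrow> complex" where
  "pdiff i f x = frechet_derivative f (at x) (axis i 1)"

definition smooth :: "(real^3 \<Rightarrow> complex) \<Rightarrow> bool" where
  "smooth f \<longleftrightarrow> (\<forall>is x. foldr pdiff is f differentiable (at x))"

definition laplacian :: "(real^3 \<Rightarrow> complex) \<Rightarrow> real^3 \<Rightarrow> complex" where
  "laplacian f x = (\<Sum>i\<in>UNIV. pdiff i (pdiff i f) x)"

definition test_function :: "(real^3 \<Rightarrow> complex) \<Rightarrow> bool" where
  "test_function \<phi> \<longleftrightarrow> smooth \<phi> \<and> compact (closure {x. \<phi> x \<noteq> 0})"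

definition schwartz :: "(real^3 \<Rightarrow> complex) \<Rightarrow> bool" where
  "schwartz \<phi> \<longleftrightarrow> smooth \<phi> \<and>
     (\<forall>is (m::nat). bounded (range (\<lambda>x. norm x ^ m *\<^sub>R foldr pdiff is \<phi> x)))"

definition fourier :: "(real^3 \<Rightarrow> complex) \<Rightarrow> real^3 \<Rightarrow> complex" where
  "fourier f \<xi> = (LINT x|lborel. cis (- (x \<bullet> \<xi>)) * f x)"

definition inv_fourier :: "(real^3 \<Rightarrow> complex) \<Rightarrow> real^3 \<Rightarrow> complex" where
  "inv_fourier f \<xi> = (LINT x|lborel. cis (x \<bullet> \<xi>) * f x) / (2 * pi) ^ 3"

section \<open>The space \<open>H\<^sup>1(\<real>\<^sup>3, \<complex>)\<close>\<close>

definition L2 :: "(real^3 \<Rightarrow> 'b::euclidean_space) set" where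
  "L2 = {f \<in> borel_measurable lborel. integrable lborel (\<lambda>x. (norm (f x))\<^sup>2)}"

definition weak_gradient :: "(real^3 \<Rightarrow> complex) \<Rightarrow> (real^3 \<Rightarrow> complex^3) \<Rightarrow> bool" where
  "weak_gradient u G \<longleftrightarrow> (\<forall>i \<phi>. test_function \<phi> \<longrightarrow>
     (LINT x|lborel. u x * pdiff i \<phi> x) = - (LINT x|lborel. G x $ i * \<phi> x))"

definition H1 :: "(real^3 \<Rightarrow> complex) set" where
  "H1 = {u \<in> L2. \<exists>G \<in> L2. weak_gradient u G}"

text \<open>The weak gradient of a function in \<^const>\<open>H1\<close> is unique up to null sets.\<close>

definition grad :: "(real^3 \<Rightarrow> complex) \<Rightarrow> real^3 \<Rightarrow> complex^3" where
  "grad u = (SOME G. G \<in> L2 \<and> weak_gradient u G)"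

definition mass :: "(real^3 \<Rightarrow> complex) \<Rightarrow> real" where
  "mass u = (LINT x|lborel. (norm (u x))\<^sup>2)"

definition kinetic :: "(real^3 \<Rightarrow> complex) \<Rightarrow> real" where
  "kinetic u = (LINT x|lborel. (norm (grad u x))\<^sup>2)"

definition H1_dist :: "(real^3 \<Rightarrow> complex) \<Rightarrow> (real^3 \<Rightarrow> complex) \<Rightarrow> real" where
  "H1_dist u v = sqrt (mass (\<lambda>x. u x - v x) + kinetic (\<lambda>x. u x - v x))"

definition H1_continuous_on :: "real set \<Rightarrow> (real \<Rightarrow> real^3 \<Rightarrow> complex) \<Rightarrow> bool" where
  "H1_continuous_on I g \<longleftrightarrow> (\<forall>t\<in>I. g t \<in> H1) \<and>
     (\<forall>s\<in>I. ((\<lambda>t. H1_dist (g t) (g s)) \<longlongrightarrow> 0) (at s within I))"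

section \<open>The dipolar operator\<close>

definition dipole_symbol :: "real^3 \<Rightarrow> real" where
  "dipole_symbol \<xi> = 4 / 3 * pi * ((2 * (\<xi>$3)\<^sup>2 - (\<xi>$1)\<^sup>2 - (\<xi>$2)\<^sup>2) / (norm \<xi>)\<^sup>2)"

text \<open>
  \<open>K \<star> f = \<F>\<^sup>-\<^sup>1 (K^ \<F> f)\<close>, where the inverse transform is that of tempered distributions:
  \<open>\<langle>\<F>\<^sup>-\<^sup>1 h, \<phi>\<rangle> = \<langle>h, \<F>\<^sup>-\<^sup>1 \<phi>\<rangle>\<close> for all Schwartz functions \<open>\<phi>\<close>. For \<open>f \<in> L\<^sup>1 \<inter> L\<^sup>2\<close>, in particular for
  \<open>f = |u|\<^sup>2\<close> with \<open>u \<in> H\<^sup>1\<close>, the result is a function in \<open>L\<^sup>2\<close>, unique up to null sets. It is real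
  for real \<open>f\<close>, since the symbol is real and even. Where no such \<open>L\<^sup>2\<close> function exists, the value
  is 0 by convention.
\<close>

definition is_dipole_conv :: "(real^3 \<Rightarrow> real) \<Rightarrow> (real^3 \<Rightarrow> real) \<Rightarrow> bool" where
  "is_dipole_conv f g \<longleftrightarrow> integrable lborel f \<and> g \<in> L2 \<and>
     (\<forall>\<phi>. schwartz \<phi> \<longrightarrow>
        (LINT x|lborel. complex_of_real (g x) * \<phi> x) =
        (LINT \<xi>|lborel. complex_of_real (dipole_symbol \<xi>)
            * fourier (\<lambda>x. complex_of_real (f x)) \<xi> * inv_fourier \<phi> \<xi>))"

definition dipole_conv :: "(real^3 \<Rightarrow> real) \<Rightarrow> real^3 \<Rightarrow> real" where
  "dipole_conv f = (if \<exists>g. is_dipole_conv f g then SOME g. is_dipole_conv f g else (\<lambda>_. 0))"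

section \<open>Functionals and the mountain pass level\<close>

definition unstable_regime :: "real \<Rightarrow> real \<Rightarrow> bool" where
  "unstable_regime lam1 lam2 \<longleftrightarrow>
     (lam2 > 0 \<and> lam1 - 4 / 3 * pi * lam2 < 0) \<or> (lam2 < 0 \<and> lam1 + 8 / 3 * pi * lam2 < 0)"

definition interaction :: "real \<Rightarrow> real \<Rightarrow> (real^3 \<Rightarrow> complex) \<Rightarrow> real" where
  "interaction lam1 lam2 u = lam1 * (LINT x|lborel. (norm (u x)) ^ 4)
     + lam2 * (LINT x|lborel. dipole_conv (\<lambda>y. (norm (u y))\<^sup>2) x * (norm (u x))\<^sup>2)"

definition energy :: "real \<Rightarrow> real \<Rightarrow> (real^3 \<Rightarrow> complex) \<Rightarrow> real" where
  "energy lam1 lam2 u = 1 / 2 * kinetic u + 1 / 2 * interaction lam1 lam2 u"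

definition virial :: "real \<Rightarrow> real \<Rightarrow> (real^3 \<Rightarrow> complex) \<Rightarrow> real" where
  "virial lam1 lam2 u = kinetic u + 3 / 2 * interaction lam1 lam2 u"

definition mass_sphere :: "real \<Rightarrow> (real^3 \<Rightarrow> complex) set" where
  "mass_sphere c = {u \<in> H1. mass u = c}"

definition mp_paths :: "real \<Rightarrow> real \<Rightarrow> real \<Rightarrow> real \<Rightarrow> (real \<Rightarrow> real^3 \<Rightarrow> complex) set" where
  "mp_paths lam1 lam2 k c = {g. H1_continuous_on {0..1} g \<and> (\<forall>t\<in>{0..1}. g t \<in> mass_sphere c) \<and>
     kinetic (g 0) \<le> k \<and> energy lam1 lam2 (g 1) < 0}"

text \<open>
  The energy is continuous on \<^const>\<open>H1\<close>, so the supremum along a path is a maximum. Infima and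
  suprema are taken in \<^typ>\<open>ereal\<close>, where they need no boundedness conditions.
\<close>

definition mp_level :: "real \<Rightarrow> real \<Rightarrow> real \<Rightarrow> real \<Rightarrow> ereal" where
  "mp_level lam1 lam2 k c =
     (INF g\<in>mp_paths lam1 lam2 k c. SUP t\<in>{0..1}. ereal (energy lam1 lam2 (g t)))"

definition mp_geometry :: "real \<Rightarrow> real \<Rightarrow> real \<Rightarrow> real \<Rightarrow> bool" where
  "mp_geometry lam1 lam2 k c \<longleftrightarrow>
     mp_level lam1 lam2 k c > max (SUP g\<in>mp_paths lam1 lam2 k c. ereal (energy lam1 lam2 (g 0)))
                            (SUP g\<in>mp_paths lam1 lam2 k c. ereal (energy lam1 lam2 (g 1)))"

section \<open>The Cauchy problem\<close>

definition time_interval :: "ereal \<Rightarrow> real set" where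
  "time_interval T = {t. 0 \<le> t \<and> ereal t < T}"

definition L4_norm :: "(real^3 \<Rightarrow> 'b::euclidean_space) \<Rightarrow> real" where
  "L4_norm f = (LINT x|lborel. norm (f x) ^ 4) powr (1 / 4)"

text \<open>
  \<open>L\<^sup>8\<^sup>/\<^sup>3\<close> in time on compact subintervals of \<open>[0, T)\<close> with values in \<open>L\<^sup>4\<close>. The first conjunct is
  needed because the integral in \<^const>\<open>L4_norm\<close> is 0 for functions outside \<open>L\<^sup>4\<close>.
\<close>

definition locally_L83_L4 :: "ereal \<Rightarrow> (real \<Rightarrow> real^3 \<Rightarrow> 'b::euclidean_space) \<Rightarrow> bool" where
  "locally_L83_L4 T f \<longleftrightarrow> (\<forall>s\<in>time_interval T.
     (AE t in lborel. t \<in> {0..s} \<longrightarrow>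
        f t \<in> borel_measurable lborel \<and> integrable lborel (\<lambda>x. norm (f t x) ^ 4)) \<and>
     set_integrable lborel {0..s} (\<lambda>t. L4_norm (f t) powr (8 / 3)))"

text \<open>
  The equation holds in the sense of distributions in \<open>x\<close> at every time \<open>t\<close>; for solutions
  in \<open>C([0, T); H\<^sup>1)\<close> this is the same as the equation in \<open>C([0, T); H\<^sup>-\<^sup>1)\<close>. The pairing with test
  functions is bilinear (no conjugation).
\<close>

definition solves_NLS :: "real \<Rightarrow> real \<Rightarrow> ereal \<Rightarrow> (real \<Rightarrow> real^3 \<Rightarrow> complex) \<Rightarrow> bool" where
  "solves_NLS lam1 lam2 T \<psi> \<longleftrightarrow> (\<forall>\<phi>. test_function \<phi> \<longrightarrow> (\<forall>t\<in>time_interval T. \<exists>D.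
     ((\<lambda>s. LINT x|lborel. \<psi> s x * \<phi> x) has_vector_derivative D) (at t within time_interval T) \<and>
     \<i> * D = - 1 / 2 * (LINT x|lborel. \<psi> t x * laplacian \<phi> x)
       + complex_of_real lam1 * (LINT x|lborel. complex_of_real ((norm (\<psi> t x))\<^sup>2) * \<psi> t x * \<phi> x)
       + complex_of_real lam2 * (LINT x|lborel.
           complex_of_real (dipole_conv (\<lambda>y. (norm (\<psi> t y))\<^sup>2) x) * \<psi> t x * \<phi> x)))"

definition solution_on ::
  "real \<Rightarrow> real \<Rightarrow> (real^3 \<Rightarrow> complex) \<Rightarrow> ereal \<Rightarrow> (real \<Rightarrow> real^3 \<Rightarrow> complex) \<Rightarrow> bool" where
  "solution_on lam1 lam2 u0 T \<psi> \<longleftrightarrow> T > 0 \<and>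
     H1_continuous_on (time_interval T) \<psi> \<and>
     locally_L83_L4 T \<psi> \<and> locally_L83_L4 T (\<lambda>t. grad (\<psi> t)) \<and>
     solves_NLS lam1 lam2 T \<psi> \<and>
     (AE x in lborel. \<psi> 0 x = u0 x)"

definition maximal_solution ::
  "real \<Rightarrow> real \<Rightarrow> (real^3 \<Rightarrow> complex) \<Rightarrow> ereal \<Rightarrow> (real \<Rightarrow> real^3 \<Rightarrow> complex) \<Rightarrow> bool" where
  "maximal_solution lam1 lam2 u0 T \<psi> \<longleftrightarrow> solution_on lam1 lam2 u0 T \<psi> \<and>
     \<not> (\<exists>T' > T. \<exists>\<psi>'. solution_on lam1 lam2 u0 T' \<psi>' \<and>
          (\<forall>t\<in>time_interval T. AE x in lborel. \<psi>' t x = \<psi> t x))"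

text \<open>
  The known local theory of the Cauchy problem: existence and uniqueness of the maximal solution,
  conservation of mass and energy, and the blow-up alternative.
\<close>

definition local_theory :: "real \<Rightarrow> real \<Rightarrow> bool" where
  "local_theory lam1 lam2 \<longleftrightarrow> (\<forall>u0\<in>H1. \<exists>T \<psi>. maximal_solution lam1 lam2 u0 T \<psi> \<and>
     (\<forall>T' \<psi>'. maximal_solution lam1 lam2 u0 T' \<psi>' \<longrightarrow>
        T' = T \<and> (\<forall>t\<in>time_interval T. AE x in lborel. \<psi>' t x = \<psi> t x)) \<and>
     (\<forall>t\<in>time_interval T. mass (\<psi> t) = mass u0 \<and> energy lam1 lam2 (\<psi> t) = energy lam1 lam2 u0) \<and>
     (T = \<infinity> \<or> filterlim (\<lambda>t. sqrt (kinetic (\<psi> t))) at_top (at_left (real_of_ereal T))))"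

end

theory Submission
  imports Defs
begin

text \<open>
  Since \<open>Q = 3 E - A / 2\<close> and \<open>E\<close> is conserved, finite-time blow-up of \<open>A(\<psi>(t))\<close> would force \<open>Q\<close> to pass
  continuously from a positive value through 0, at a time where \<open>v = \<psi>(t)\<close> satisfies \<open>E(v) = E(u\<^sub>0)\<close>.
  The mass-preserving dilations \<open>v\<^sub>t(x) = t\<^bsup>3/2\<^esup> v(t x)\<close> satisfy \<open>E(v\<^sub>t) = t\<^sup>2/2 A(v) + t\<^sup>3/2 B(v)\<close>, because the
  dipolar symbol is homogeneous of degree 0. When \<open>Q(v) = 0\<close> this has its maximum at \<open>t = 1\<close>, so the
  dilations form an admissible path and \<open>\<gamma>(c) \<le> E(v) = E(u\<^sub>0)\<close>, a contradiction.
\<close>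

section \<open>Smooth functions\<close>

text \<open>Conservation of the energy turns the sign of Q into a comparison of A with the fixed
  level 6E, so along the flow the intermediate value theorem is applied to \<open>kinetic\<close>
  alone, which is continuous for the H^1 distance. Along dilations the energy is an explicit cubic
  polynomial in t, and bounding it is elementary algebra. The form of the definitions shapes the
  rest. \<open>grad\<close> and \<open>dipole_conv\<close> are choices among almost everywhere equal
  functions, known only through pairings with smooth functions. A scaling law is therefore proved
  for the weak characterisation, by moving the dilation onto the test function, and then transferred
  by uniqueness. Uniqueness requires enough test functions, which are built from exp(-1/t). The
  default value 0 of divergent integrals and of \<open>dipole_conv\<close> is compatible with
  dilation, so the laws cover these cases too. Admissibility of the path rests on the strong
  continuity of dilations, obtained from the density of compactly supported continuous functions in
  L^2.\<close>

lemma smoothI_invariant: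
  assumes "P f"
    and diff: "\<And>g x. P g \<Longrightarrow> g differentiable (at x)"
    and closed: "\<And>g i. P g \<Longrightarrow> P (pdiff i g)"
  shows "smooth f"
  unfolding smooth_def
proof (intro allI)
  fix "is" x
  \<comment> \<open>Coinduction in effect: \<open>smooth\<close> is the largest class of
    differentiable functions closed under \<open>pdiff\<close>, so it suffices to exhibit one such
    class that contains \<open>f\<close>.\<close>
  have "P (foldr pdiff is f)"
    by (induction "is") (use assms(1) closed in auto)
  then show "foldr pdiff is f differentiable (at x)" by (rule diff)
qed

lemma smooth_differentiable: "smooth f \<Longrightarrow> f differentiable (at x)"
  unfolding smooth_def by (drule spec[of _ "[]"]) simp

lemma smooth_pdiff: "smooth f \<Longrightarrow> smooth (pdiff i f)"
  unfolding smooth_def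
proof (intro allI)
  fix "is" x assume "\<forall>is x. foldr pdiff is f differentiable (at x)"
  \<comment> \<open>\<open>foldr\<close> applies the last entry of the list first, hence the extra
    direction is appended at the end.\<close>
  then have "foldr pdiff (is @ [i]) f differentiable (at x)" by (elim allE)
  then show "foldr pdiff is (pdiff i f) differentiable (at x)" by simp
qed

lemma smooth_foldr_pdiff: "smooth f \<Longrightarrow> smooth (foldr pdiff is f)"
  by (induction "is") (auto intro: smooth_pdiff)

lemma smooth_continuous_on: "smooth f \<Longrightarrow> continuous_on S f"
  by (intro continuous_at_imp_continuous_on ballI differentiable_imp_continuous_within smooth_differentiable)

lemma smooth_borel_measurable: "smooth f \<Longrightarrow> f \<in> borel_measurable borel"
  by (simp add: borel_measurable_continuous_onI smooth_continuous_on)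

lemma pdiff_eqI: "(f has_derivative f') (at x) \<Longrightarrow> pdiff i f x = f' (axis i 1)"
  unfolding pdiff_def using frechet_derivative_at[of f f' x] by simp

lemma has_derivative_frechet:
  "f differentiable (at x) \<Longrightarrow> (f has_derivative frechet_derivative f (at x)) (at x)"
  by (simp add: frechet_derivative_works)

lemma pdiff_add:
  assumes "f differentiable (at x)" "g differentiable (at x)"
  shows "pdiff i (\<lambda>x. f x + g x) x = pdiff i f x + pdiff i g x"
  by (subst pdiff_eqI[OF has_derivative_add[OF assms[THEN has_derivative_frechet]]])
     (simp add: pdiff_def)

lemma pdiff_mult:
  assumes "f differentiable (at x)" "g differentiable (at x)"
  shows "pdiff i (\<lambda>x. f x * g x) x = f x * pdiff i g x + pdiff i f x * g x"
  by (subst pdiff_eqI[OF has_derivative_mult[OF assms[THEN has_derivative_frechet]]])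
     (simp add: pdiff_def)

text \<open>By the Leibniz rule the derivative of a product is a sum of products. Products of smooth
  functions are therefore embedded in the algebra they generate, which is visibly closed under
  \<open>pdiff\<close>, as \<open>smoothI_invariant\<close> demands.\<close>

inductive smooth_algebra :: "(real^3 \<Rightarrow> complex) \<Rightarrow> bool" where
  base: "smooth f \<Longrightarrow> smooth_algebra f"
| add: "smooth_algebra f \<Longrightarrow> smooth_algebra g \<Longrightarrow> smooth_algebra (\<lambda>x. f x + g x)"
| mult: "smooth_algebra f \<Longrightarrow> smooth_algebra g \<Longrightarrow> smooth_algebra (\<lambda>x. f x * g x)"

lemma smooth_algebra_differentiable: "smooth_algebra f \<Longrightarrow> f differentiable (at x)"
  by (induction rule: smooth_algebra.induct)
     (auto intro: smooth_differentiable differentiable_add differentiable_mult)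

lemma smooth_algebra_pdiff: "smooth_algebra f \<Longrightarrow> smooth_algebra (pdiff i f)"
proof (induction rule: smooth_algebra.induct)
  case (base f)
  then show ?case by (intro smooth_algebra.base smooth_pdiff)
next
  case (add f g)
  then have "pdiff i (\<lambda>x. f x + g x) = (\<lambda>x. pdiff i f x + pdiff i g x)"
    by (intro ext pdiff_add smooth_algebra_differentiable)
  with add show ?case by (auto intro: smooth_algebra.add)
next
  case (mult f g)
  then have "pdiff i (\<lambda>x. f x * g x) = (\<lambda>x. f x * pdiff i g x + pdiff i f x * g x)"
    by (intro ext pdiff_mult smooth_algebra_differentiable)
  with mult show ?case by (auto intro: smooth_algebra.add smooth_algebra.mult)
qed

lemma smooth_algebra_smooth: "smooth_algebra f \<Longrightarrow> smooth f"
  by (rule smoothI_invariant[of smooth_algebra])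
     (assumption | rule smooth_algebra_differentiable smooth_algebra_pdiff)+

lemma smooth_mult: "smooth f \<Longrightarrow> smooth g \<Longrightarrow> smooth (\<lambda>x. f x * g x)"
  by (rule smooth_algebra_smooth[OF smooth_algebra.mult[OF smooth_algebra.base smooth_algebra.base]])

lemma pdiff_const: "pdiff i (\<lambda>x. c) = (\<lambda>x. 0)"
  by (rule ext) (simp add: pdiff_eqI[OF has_derivative_const])

lemma smooth_const: "smooth (\<lambda>x. c)"
proof (rule smoothI_invariant[of "\<lambda>f. \<exists>c. f = (\<lambda>x. c)"])
  show "\<exists>c'. pdiff i g = (\<lambda>x. c')" if "\<exists>c. g = (\<lambda>x. c)" for g i
    using that by (auto simp: pdiff_const)
qed (auto intro: differentiable_const)

lemma smooth_prod:
  assumes "finite I" "\<And>i. i \<in> I \<Longrightarrow> smooth (f i)"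
  shows "smooth (\<lambda>x. \<Prod>i\<in>I. f i x)"
  using assms by (induction I rule: finite_induct) (auto intro: smooth_const smooth_mult)

section \<open>Smoothness and partial derivatives under homotheties\<close>

lemma differentiable_scaled:
  fixes f :: "real^3 \<Rightarrow> complex"
  assumes "\<And>x. f differentiable (at x)"
  shows "(\<lambda>x. f (a *\<^sub>R x)) differentiable (at x)"
  using differentiable_chain_at[of "\<lambda>x. a *\<^sub>R x" x f] assms by (simp add: o_def)

lemma pdiff_scaled:
  assumes "\<And>x. f differentiable (at x)"
  shows "pdiff i (\<lambda>x. f (a *\<^sub>R x)) x = a *\<^sub>R pdiff i f (a *\<^sub>R x)"
proof -
  have lin: "((\<lambda>x. a *\<^sub>R x) has_derivative (\<lambda>x. a *\<^sub>R x)) (at x)"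
    by (intro has_derivative_scaleR_right has_derivative_ident)
  have f: "(f has_derivative frechet_derivative f (at (a *\<^sub>R x))) (at (a *\<^sub>R x))"
    using assms by (rule has_derivative_frechet)
  have "pdiff i (\<lambda>x. f (a *\<^sub>R x)) x = frechet_derivative f (at (a *\<^sub>R x)) (a *\<^sub>R axis i 1)"
    by (rule pdiff_eqI[OF has_derivative_compose[OF lin f]])
  also have "\<dots> = a *\<^sub>R pdiff i f (a *\<^sub>R x)"
    using has_derivative_linear[OF f] by (simp add: pdiff_def linear_scale)
  finally show ?thesis .
qed

lemma foldr_pdiff_scaled:
  assumes "smooth f"
  shows "foldr pdiff is (\<lambda>x. f (a *\<^sub>R x)) = (\<lambda>x. a ^ length is *\<^sub>R foldr pdiff is f (a *\<^sub>R x))"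
proof (induction "is")
  case (Cons i "is")
  let ?g = "foldr pdiff is f"
  have d: "?g differentiable (at x)" for x
    using assms by (intro smooth_differentiable smooth_foldr_pdiff)
  show ?case
  proof
    fix x
    have "foldr pdiff (i # is) (\<lambda>x. f (a *\<^sub>R x)) x =
      pdiff i (\<lambda>x. of_real (a ^ length is) * ?g (a *\<^sub>R x)) x"
      using Cons by (simp add: scaleR_conv_of_real)
    also have "\<dots> = of_real (a ^ length is) * (a *\<^sub>R pdiff i ?g (a *\<^sub>R x))"
      by (subst pdiff_mult)
         (simp_all add: pdiff_const pdiff_scaled d differentiable_scaled)
    also have "\<dots> = a ^ length (i # is) *\<^sub>R foldr pdiff (i # is) f (a *\<^sub>R x)"
      by (simp add: scaleR_conv_of_real)
    finally show "foldr pdiff (i # is) (\<lambda>x. f (a *\<^sub>R x)) x =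
      a ^ length (i # is) *\<^sub>R foldr pdiff (i # is) f (a *\<^sub>R x)" .
  qed
qed auto

lemma smooth_scaled:
  assumes "smooth f"
  shows "smooth (\<lambda>x. f (a *\<^sub>R x))"
  unfolding smooth_def
proof (intro allI)
  fix "is" x
  have "(\<lambda>x. a ^ length is *\<^sub>R foldr pdiff is f (a *\<^sub>R x)) differentiable (at x)"
    by (intro differentiable_scaleR differentiable_const differentiable_scaled
        smooth_differentiable smooth_foldr_pdiff assms)
  then show "foldr pdiff is (\<lambda>x. f (a *\<^sub>R x)) differentiable (at x)"
    by (simp add: foldr_pdiff_scaled[OF assms])
qed

section \<open>Test functions\<close>

text \<open>The complement of the closed support is open, so \<open>f\<close> vanishes in a whole
  neighbourhood of \<open>x\<close>.\<close>

lemma pdiff_eq_0_outside: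
  assumes "x \<notin> closure {x. f x \<noteq> 0}"
  shows "pdiff i f x = 0"
proof -
  have sub: "f y = 0" if "y \<notin> closure {x. f x \<noteq> 0}" for y
    using closure_subset[of "{x. f x \<noteq> 0}"] that by auto
  have "((\<lambda>_. 0) has_derivative (\<lambda>_. 0)) (at x)" by simp
  then have "(f has_derivative (\<lambda>_. 0)) (at x)"
  proof (rule has_derivative_transform_within_open)
    show "open (- closure {x. f x \<noteq> 0})" by blast
    show "x \<in> - closure {x. f x \<noteq> 0}" using assms by blast
    show "0 = f y" if "y \<in> - closure {x. f x \<noteq> 0}" for y
      using that by (intro sub[symmetric]) simp
  qed
  from pdiff_eqI[OF this] show ?thesis by simp
qed

lemma test_function_pdiff:
  assumes "test_function \<phi>"
  shows "test_function (pdiff i \<phi>)"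
proof -
  have sub: "{x. pdiff i \<phi> x \<noteq> 0} \<subseteq> closure {x. \<phi> x \<noteq> 0}"
    using pdiff_eq_0_outside by blast
  have "bounded (closure {x. \<phi> x \<noteq> 0})"
    using assms by (simp add: test_function_def compact_imp_bounded)
  then have "bounded {x. pdiff i \<phi> x \<noteq> 0}"
    using sub by (rule bounded_subset)
  then show ?thesis
    using assms by (simp add: test_function_def smooth_pdiff)
qed

lemma test_function_foldr_pdiff: "test_function \<phi> \<Longrightarrow> test_function (foldr pdiff is \<phi>)"
  by (induction "is") (auto intro: test_function_pdiff)

lemma test_function_smooth: "test_function \<phi> \<Longrightarrow> smooth \<phi>"
  by (simp add: test_function_def)

lemma test_function_bounded_support:
  assumes "test_function \<phi>"
  obtains R where "R > 0" "\<And>x. norm x > R \<Longrightarrow> \<phi> x = 0"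
proof -
  have "bounded (closure {x. \<phi> x \<noteq> 0})"
    using assms by (simp add: test_function_def compact_imp_bounded)
  then obtain R where "R > 0" "\<And>x. x \<in> closure {x. \<phi> x \<noteq> 0} \<Longrightarrow> norm x \<le> R"
    by (meson bounded_pos)
  moreover have "{x. \<phi> x \<noteq> 0} \<subseteq> closure {x. \<phi> x \<noteq> 0}" by (rule closure_subset)
  ultimately have "norm x \<le> R" if "\<phi> x \<noteq> 0" for x using that by blast
  with that[of R] \<open>R > 0\<close> show ?thesis by (meson linorder_not_less)
qed

lemma test_functionI:
  assumes "smooth \<phi>" "\<And>x. norm x > R \<Longrightarrow> \<phi> x = 0"
  shows "test_function \<phi>"
proof -
  have "bounded {x. \<phi> x \<noteq> 0}"
    unfolding bounded_iff using assms(2) by (intro exI[of _ R]) (force simp: not_le)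
  then show ?thesis using assms(1) by (simp add: test_function_def)
qed

lemma test_function_bounded:
  assumes "test_function \<phi>"
  obtains M where "M > 0" "\<And>x. norm (\<phi> x) \<le> M"
proof -
  obtain R where R: "R > 0" "\<And>x. norm x > R \<Longrightarrow> \<phi> x = 0"
    using test_function_bounded_support[OF assms] by blast
  have "bounded (\<phi> ` cball 0 R)"
    using assms by (intro compact_imp_bounded compact_continuous_image smooth_continuous_on test_function_smooth) auto
  then obtain M where M: "M > 0" "\<And>x. x \<in> cball 0 R \<Longrightarrow> norm (\<phi> x) \<le> M"
    by (auto simp: bounded_pos)
  have "norm (\<phi> x) \<le> M" for x
    using M(2)[of x] R(2)[of x] M(1) by (cases "norm x \<le> R") auto
  with that M(1) show ?thesis by blast
qed

lemma test_function_scaled: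
  assumes "test_function \<phi>" "a > 0"
  shows "test_function (\<lambda>x. \<phi> (a *\<^sub>R x))"
proof -
  obtain R where R: "R > 0" "\<And>x. norm x > R \<Longrightarrow> \<phi> x = 0"
    using test_function_bounded_support[OF assms(1)] by blast
  show ?thesis
  proof (rule test_functionI[of _ "R / a"])
    show "smooth (\<lambda>x. \<phi> (a *\<^sub>R x))"
      using assms(1) by (intro smooth_scaled test_function_smooth)
    show "\<phi> (a *\<^sub>R x) = 0" if "norm x > R / a" for x
      using that \<open>a > 0\<close> by (intro R) (simp add: field_simps)
  qed
qed

lemma test_function_schwartz:
  assumes "test_function \<phi>"
  shows "schwartz \<phi>"
  unfolding schwartz_def
proof (intro conjI allI)
  fix "is" and m :: nat
  let ?g = "foldr pdiff is \<phi>"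
  have g: "test_function ?g" using assms by (rule test_function_foldr_pdiff)
  obtain R where R: "R > 0" "\<And>x. norm x > R \<Longrightarrow> ?g x = 0"
    using test_function_bounded_support[OF g] by blast
  obtain M where M: "M > 0" "\<And>x. norm (?g x) \<le> M"
    using test_function_bounded[OF g] by blast
  have "norm (norm x ^ m *\<^sub>R ?g x) \<le> R ^ m * M" for x
  proof (cases "norm x \<le> R")
    case True
    then show ?thesis using M R by (auto intro!: mult_mono power_mono)
  qed (use R M in auto)
  then show "bounded (range (\<lambda>x. norm x ^ m *\<^sub>R ?g x))"
    by (auto simp: bounded_iff)
qed (use assms in \<open>simp add: test_function_smooth\<close>)

lemma schwartz_scaled:
  assumes "schwartz \<phi>" "a > 0"
  shows "schwartz (\<lambda>x. \<phi> (a *\<^sub>R x))"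
  unfolding schwartz_def
proof (intro conjI allI)
  fix "is" and m :: nat
  from assms have s: "smooth \<phi>" by (simp add: schwartz_def)
  then show "smooth (\<lambda>x. \<phi> (a *\<^sub>R x))" by (rule smooth_scaled)
  from assms have "bounded (range (\<lambda>x. norm x ^ m *\<^sub>R foldr pdiff is \<phi> x))"
    unfolding schwartz_def by blast
  then obtain M where M: "\<And>x. norm (norm x ^ m *\<^sub>R foldr pdiff is \<phi> x) \<le> M"
    unfolding bounded_iff by blast
  \<comment> \<open>Each derivative contributes a factor \<open>a\<close>, and replacing the weight
    at \<open>x\<close> by the weight at \<open>a *\<^sub>R x\<close> costs
    \<open>1 / a ^ m\<close>.\<close>
  have "norm (norm x ^ m *\<^sub>R foldr pdiff is (\<lambda>x. \<phi> (a *\<^sub>R x)) x) \<le> a ^ length is / a ^ m * M" for x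
  proof -
    have "norm (norm x ^ m *\<^sub>R foldr pdiff is (\<lambda>x. \<phi> (a *\<^sub>R x)) x) =
      a ^ length is / a ^ m * norm (norm (a *\<^sub>R x) ^ m *\<^sub>R foldr pdiff is \<phi> (a *\<^sub>R x))"
      using \<open>a > 0\<close> by (simp add: foldr_pdiff_scaled[OF s] power_mult_distrib field_simps)
    also have "\<dots> \<le> a ^ length is / a ^ m * M"
      by (rule mult_left_mono[OF M]) (use \<open>a > 0\<close> in auto)
    finally show ?thesis .
  qed
  then show "bounded (range (\<lambda>x. norm x ^ m *\<^sub>R foldr pdiff is (\<lambda>x. \<phi> (a *\<^sub>R x)) x))"
    by (auto simp: bounded_iff)
qed

text \<open>For \<open>p = 1\<close> this is the classical smooth function exp(-1/t) that vanishes
  to infinite order at 0. Its derivatives carry polynomial factors in 1/t; admitting these from the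
  start makes the family closed under differentiation.\<close>

definition flat :: "real poly \<Rightarrow> real \<Rightarrow> real" where
  "flat p t = (if t > 0 then poly p (1 / t) * exp (- (1 / t)) else 0)"

lemma poly_exp_tendsto_0:
  "((\<lambda>y. poly p y * exp (- y)) \<longlongrightarrow> (0::real)) at_top"
proof -
  have "((\<lambda>y. \<Sum>i\<le>degree p. coeff p i * (y ^ i / exp y)) \<longlongrightarrow> (\<Sum>i\<le>degree p. coeff p i * 0)) at_top"
    by (intro tendsto_sum tendsto_mult tendsto_const tendsto_power_div_exp_0)
  then show ?thesis
    by (simp add: poly_altdef exp_minus divide_inverse sum_distrib_right mult.assoc)
qed

lemma flat_tendsto_0: "((\<lambda>t. flat p t) \<longlongrightarrow> 0) (at_right 0)"
proof -
  have "((\<lambda>t. poly p (inverse t) * exp (- inverse t)) \<longlongrightarrow> 0) (at_right (0::real))"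
    by (rule filterlim_compose[OF poly_exp_tendsto_0 filterlim_inverse_at_top_right])
  then show ?thesis
    by (rule Lim_transform_eventually)
       (auto simp: eventually_at_filter flat_def inverse_eq_divide)
qed

text \<open>With y = 1/t one has dy/dt = -y^2, so p(y) exp(-y) has the derivative y^2 (p - p')(y)
  exp(-y); the polynomial \<open>[:0, 0, 1:]\<close> is the factor y^2. Only t = 0 needs the decay
  of the exponential.\<close>

lemma has_real_derivative_flat:
  "(flat p has_real_derivative flat ([:0, 0, 1:] * (p - pderiv p)) t) (at t)"
proof -
  consider "t > 0" | "t < 0" | "t = 0" by linarith
  then show ?thesis
  proof cases
    case 1
    have "((\<lambda>t. poly p (1 / t) * exp (- (1 / t))) has_real_derivative
        flat ([:0, 0, 1:] * (p - pderiv p)) t) (at t)"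
      using 1 by (auto intro!: derivative_eq_intros simp: flat_def field_simps power2_eq_square)
    moreover have "\<forall>\<^sub>F s in nhds t. flat p s = poly p (1 / s) * exp (- (1 / s))"
      using eventually_nhds_in_open[of "{0<..}" t] 1
      by (auto simp: flat_def elim!: eventually_mono)
    ultimately show ?thesis by (simp add: DERIV_cong_ev)
  next
    case 2
    have "\<forall>\<^sub>F s in nhds t. flat p s = 0"
      using eventually_nhds_in_open[of "{..<0}" t] 2
      by (auto simp: flat_def elim!: eventually_mono)
    then have "(flat p has_real_derivative 0) (at t) \<longleftrightarrow> ((\<lambda>_. 0) has_real_derivative 0) (at t)"
      by (intro DERIV_cong_ev) auto
    then show ?thesis using 2 by (simp add: flat_def)
  next
    case 3
    \<comment> \<open>To the right of 0, division by \<open>h\<close> is one more factor 1/h, so the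
      difference quotient is \<open>flat (pCons 0 p) h\<close> and again tends to 0.\<close>
    have "((\<lambda>h. flat p h / h) \<longlongrightarrow> 0) (at_right 0)"
      by (rule Lim_transform_eventually[OF flat_tendsto_0[of "pCons 0 p"]])
         (auto simp: eventually_at_filter flat_def)
    moreover have "((\<lambda>h. flat p h / h) \<longlongrightarrow> 0) (at_left 0)"
      by (rule tendsto_eventually) (auto simp: eventually_at_filter flat_def)
    ultimately have "((\<lambda>h. flat p h / h) \<longlongrightarrow> 0) (at 0)"
      by (simp add: filterlim_split_at)
    then show ?thesis using 3 by (simp add: has_field_derivative_iff flat_def)
  qed
qed

lemma has_derivative_flat_component:
  fixes x :: "real^3"
  shows "((\<lambda>x. complex_of_real (flat p (c * x $ j + d))) has_derivative
    (\<lambda>h. complex_of_real (flat ([:0, 0, 1:] * (p - pderiv p)) (c * x $ j + d) * (c * h $ j)))) (at x)"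
proof -
  have "((\<lambda>x. c * x $ j + d) has_derivative (\<lambda>h. c * h $ j)) (at x)"
    by (auto intro!: derivative_eq_intros bounded_linear.has_derivative[OF bounded_linear_vec_nth])
  from has_derivative_compose[OF this has_real_derivative_flat[unfolded has_field_derivative_def]]
  show ?thesis
    by (intro has_derivative_of_real) auto
qed

lemma smooth_flat_component:
  fixes j :: 3
  shows "smooth (\<lambda>x. complex_of_real (flat p (c * x $ j + d)))"
proof (rule smoothI_invariant[of "\<lambda>f. \<exists>p. f = (\<lambda>x. complex_of_real (flat p (c * x $ j + d)))"])
  fix g :: "real^3 \<Rightarrow> complex" and i :: 3
  assume "\<exists>p. g = (\<lambda>x. complex_of_real (flat p (c * x $ j + d)))"
  then obtain p where g: "g = (\<lambda>x. complex_of_real (flat p (c * x $ j + d)))" by blast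
  \<comment> \<open>The factor \<open>c * axis i 1 $ j\<close> from the chain rule, zero unless
    \<open>i = j\<close>, is absorbed into the polynomial, so the derivative stays in the
    family.\<close>
  have "pdiff i g = (\<lambda>x. complex_of_real (flat (smult (c * axis i 1 $ j) ([:0, 0, 1:] * (p - pderiv p))) (c * x $ j + d)))"
    unfolding g by (rule ext, subst pdiff_eqI[OF has_derivative_flat_component]) (simp add: flat_def)
  then show "\<exists>p. pdiff i g = (\<lambda>x. complex_of_real (flat p (c * x $ j + d)))" by blast
next
  show "g differentiable (at x)"
    if "\<exists>p. g = (\<lambda>x. complex_of_real (flat p (c * x $ j + d)))" for g and x :: "real^3"
    using that has_derivative_flat_component differentiableI by fastforce
qed (rule exI, rule refl)

text \<open>\<open>flat 1 (n * s)\<close> is 0 for s \<le> 0 and tends to 1 for s > 0, so one such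
  factor for each face of the box gives the indicator in the limit. The approximants are supported
  inside the open box, so its indicator dominates all of them.\<close>

lemma box_indicator_approx:
  fixes a b :: "real^3"
  obtains \<phi> where "\<And>n. test_function (\<lambda>x. complex_of_real (\<phi> n x))"
    "\<And>n x. 0 \<le> \<phi> n x \<and> \<phi> n x \<le> 1"
    "\<And>x. (\<lambda>n. \<phi> n x) \<longlonglongrightarrow> indicator (box a b) x"
    "\<And>n x. x \<notin> box a b \<Longrightarrow> \<phi> n x = 0"
proof -
  \<comment> \<open>The arguments are kept in the affine form \<open>c * x $ j + d\<close> of
    \<open>smooth_flat_component\<close>; \<open>Suc n\<close> keeps the slope nonzero.\<close>
  define \<phi> where "\<phi> n x = (\<Prod>j\<in>UNIV. flat 1 (real (Suc n) * x $ j + - (real (Suc n) * a $ j)) *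
      flat 1 (- real (Suc n) * x $ j + real (Suc n) * b $ j))" for n :: nat and x :: "real^3"
  have flat_bounds: "0 \<le> flat 1 t \<and> flat 1 t \<le> 1" for t by (simp add: flat_def)
  have zero: "\<phi> n x = 0" if "x \<notin> box a b" for n x
  proof -
    from that obtain j where "x $ j \<le> a $ j \<or> b $ j \<le> x $ j"
      by (auto simp: mem_box_cart not_less)
    then have "real (Suc n) * (x $ j - a $ j) \<le> 0 \<or> real (Suc n) * (b $ j - x $ j) \<le> 0"
      by (auto simp: mult_le_0_iff)
    then show ?thesis unfolding \<phi>_def flat_def
      by (intro prod_zero) (auto intro!: exI[of _ j] simp: algebra_simps)
  qed
  show ?thesis
  proof (rule that[of \<phi>])
    fix n
    have "smooth (\<lambda>x. complex_of_real (\<phi> n x))"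
      unfolding \<phi>_def of_real_prod of_real_mult
      by (intro smooth_prod smooth_mult smooth_flat_component) auto
    moreover obtain R where "\<And>x. x \<in> box a b \<Longrightarrow> norm x \<le> R"
      using bounded_box[of a b] unfolding bounded_iff by blast
    then have "complex_of_real (\<phi> n x) = 0" if "norm x > R" for x
      using zero[of x n] that by (auto simp: not_le[symmetric])
    ultimately show "test_function (\<lambda>x. complex_of_real (\<phi> n x))"
      by (rule test_functionI)
  next
    show "0 \<le> \<phi> n x \<and> \<phi> n x \<le> 1" for n x
      unfolding \<phi>_def using flat_bounds
      by (auto intro!: prod_nonneg prod_le_1 mult_le_one)
  next
    fix x
    have lim: "(\<lambda>n. flat 1 (real (Suc n) * s)) \<longlonglongrightarrow> 1" if "s > 0" for s
    proof -
      have "(\<lambda>n. exp (- (inverse (real (Suc n)) / s))) \<longlonglongrightarrow> exp (- (0 / s))"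
        by (intro tendsto_intros LIMSEQ_inverse_real_of_nat) (use that in auto)
      moreover have "flat 1 (real (Suc n) * s) = exp (- (inverse (real (Suc n)) / s))" for n
      proof -
        have "real (Suc n) * s > 0" using that by simp
        then show ?thesis by (simp add: flat_def inverse_eq_divide del: of_nat_Suc)
      qed
      ultimately show ?thesis by simp
    qed
    show "(\<lambda>n. \<phi> n x) \<longlonglongrightarrow> indicator (box a b) x"
    proof (cases "x \<in> box a b")
      case True
      have "(\<lambda>n. \<Prod>j\<in>UNIV. flat 1 (real (Suc n) * (x $ j - a $ j)) * flat 1 (real (Suc n) * (b $ j - x $ j)))
          \<longlonglongrightarrow> (\<Prod>j\<in>(UNIV :: 3 set). 1 * 1)"
        by (intro tendsto_prod tendsto_mult lim) (use True in \<open>auto simp: mem_box_cart\<close>)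
      then show ?thesis using True by (simp add: \<phi>_def algebra_simps del: of_nat_Suc)
    qed (simp add: zero)
  qed (rule zero)
qed

section \<open>Square integrable functions\<close>

lemma L2_measurable: "f \<in> L2 \<Longrightarrow> f \<in> borel_measurable borel"
  by (simp add: L2_def)

lemma L2_integrable: "f \<in> L2 \<Longrightarrow> integrable lborel (\<lambda>x. (norm (f x))\<^sup>2)"
  by (simp add: L2_def)

text \<open>Cauchy-Schwarz with weights: the defect is a perfect square divided by \<beta>\<gamma>.
  Equal weights give the bound 2(|x|^2 + |y|^2); weights close to the two L^2 norms give the
  Minkowski inequality.\<close>

lemma norm_add_power2_le:
  fixes x y :: "'a::real_normed_vector"
  assumes "\<beta> > 0" "\<gamma> > 0"
  shows "(norm (x + y))\<^sup>2 \<le> (\<beta> + \<gamma>) * ((norm x)\<^sup>2 / \<beta> + (norm y)\<^sup>2 / \<gamma>)"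
proof -
  have "(norm (x + y))\<^sup>2 \<le> (norm x + norm y)\<^sup>2"
    by (intro power_mono norm_triangle_ineq) auto
  also have "\<dots> \<le> (\<beta> + \<gamma>) * ((norm x)\<^sup>2 / \<beta> + (norm y)\<^sup>2 / \<gamma>)"
  proof -
    have "(\<beta> + \<gamma>) * ((norm x)\<^sup>2 / \<beta> + (norm y)\<^sup>2 / \<gamma>) - (norm x + norm y)\<^sup>2
        = (\<gamma> * norm x - \<beta> * norm y)\<^sup>2 / (\<beta> * \<gamma>)"
      using assms by (simp add: field_simps power2_eq_square)
    also have "\<dots> \<ge> 0" using assms by simp
    finally show ?thesis by simp
  qed
  finally show ?thesis .
qed

lemma L2_add:
  assumes "f \<in> L2" "g \<in> L2"
  shows "(\<lambda>x. f x + g x) \<in> L2"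
proof -
  note [measurable] = assms[THEN L2_measurable]
  have "integrable lborel (\<lambda>x. (norm (f x + g x))\<^sup>2)"
  proof (rule Bochner_Integration.integrable_bound)
    show "integrable lborel (\<lambda>x. 2 * ((norm (f x))\<^sup>2 + (norm (g x))\<^sup>2))"
      using assms[THEN L2_integrable] by auto
    show "AE x in lborel. norm ((norm (f x + g x))\<^sup>2) \<le> norm (2 * ((norm (f x))\<^sup>2 + (norm (g x))\<^sup>2))"
      using norm_add_power2_le[of 1 1] by (intro AE_I2) simp
  qed measurable
  then show ?thesis by (simp add: L2_def)
qed

lemma L2_scaleR:
  assumes "f \<in> L2"
  shows "(\<lambda>x. c *\<^sub>R f x) \<in> L2"
  using assms by (auto simp: L2_def power_mult_distrib)

lemma L2_diff: "f \<in> L2 \<Longrightarrow> g \<in> L2 \<Longrightarrow> (\<lambda>x. f x - g x) \<in> L2"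
  using L2_add[of f "\<lambda>x. -1 *\<^sub>R g x"] L2_scaleR[of g "-1"] by simp

lemma L2_of_real: "f \<in> L2 \<Longrightarrow> (\<lambda>x. complex_of_real (f x)) \<in> L2"
  by (auto simp: L2_def)

lemma L2_vec_nth:
  fixes G :: "real^3 \<Rightarrow> complex^3"
  assumes "G \<in> L2"
  shows "(\<lambda>x. G x $ i) \<in> L2"
proof -
  note [measurable] = assms[THEN L2_measurable]
  have [measurable]: "(\<lambda>x. G x $ i) \<in> borel_measurable borel"
    by (rule borel_measurable_continuous_on[OF _ L2_measurable[OF assms]]) (intro continuous_intros)
  have "integrable lborel (\<lambda>x. (norm (G x $ i))\<^sup>2)"
  proof (rule Bochner_Integration.integrable_bound[OF L2_integrable[OF assms]])
    show "AE x in lborel. norm ((norm (G x $ i))\<^sup>2) \<le> norm ((norm (G x))\<^sup>2)"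
      by (auto intro!: power_mono Finite_Cartesian_Product.norm_nth_le)
  qed measurable
  then show ?thesis by (simp add: L2_def)
qed

lemma L2_bounded_support:
  assumes "f \<in> borel_measurable borel" "\<And>x. norm (f x) \<le> M" "\<And>x. norm x > R \<Longrightarrow> f x = 0"
  shows "f \<in> L2"
proof -
  note [measurable] = assms(1)
  have "integrable lborel (\<lambda>x. (norm (f x))\<^sup>2)"
  proof (rule Bochner_Integration.integrable_bound)
    have "emeasure lborel (cball 0 R :: (real^3) set) < \<infinity>"
      by (intro emeasure_bounded_finite) auto
    then show "integrable lborel (\<lambda>x. M\<^sup>2 * indicator (cball 0 R :: (real^3) set) x :: real)"
      by simp
    show "AE x in lborel. norm ((norm (f x))\<^sup>2) \<le> norm (M\<^sup>2 * indicator (cball 0 R) x :: real)"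
    proof (intro AE_I2)
      fix x
      show "norm ((norm (f x))\<^sup>2) \<le> norm (M\<^sup>2 * indicator (cball 0 R) x :: real)"
        using assms(3)[of x] power_mono[OF assms(2)[of x], of 2]
        by (cases "norm x \<le> R") auto
    qed
  qed measurable
  then show ?thesis by (simp add: L2_def)
qed

lemma test_function_L2:
  assumes "test_function \<phi>"
  shows "\<phi> \<in> L2"
proof -
  obtain R where "\<And>x. norm x > R \<Longrightarrow> \<phi> x = 0"
    using test_function_bounded_support[OF assms] by blast
  moreover obtain M where "\<And>x. norm (\<phi> x) \<le> M"
    using test_function_bounded[OF assms] by blast
  ultimately show ?thesis
    using assms by (intro L2_bounded_support[of _ M R] smooth_borel_measurable test_function_smooth)
qed

lemma L2_integrable_mult:
  fixes f g :: "real^3 \<Rightarrow> 'b::{euclidean_space, real_normed_algebra}"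
  assumes "f \<in> L2" "g \<in> L2"
  shows "integrable lborel (\<lambda>x. f x * g x)"
proof (rule Bochner_Integration.integrable_bound)
  note [measurable] = assms[THEN L2_measurable]
  show "integrable lborel (\<lambda>x. (norm (f x))\<^sup>2 + (norm (g x))\<^sup>2)"
    using assms[THEN L2_integrable] by auto
  show "AE x in lborel. norm (f x * g x) \<le> norm ((norm (f x))\<^sup>2 + (norm (g x))\<^sup>2)"
  proof (intro AE_I2)
    fix x
    have "norm (f x * g x) \<le> norm (f x) * norm (g x)" by (rule norm_mult_ineq)
    also have "\<dots> \<le> (norm (f x))\<^sup>2 + (norm (g x))\<^sup>2"
      using sum_squares_bound[of "norm (f x)" "norm (g x)"] mult_nonneg_nonneg[OF norm_ge_zero norm_ge_zero, of "f x" "g x"]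
      by linarith
    finally show "norm (f x * g x) \<le> norm ((norm (f x))\<^sup>2 + (norm (g x))\<^sup>2)" by simp
  qed
  show "(\<lambda>x. f x * g x) \<in> borel_measurable lborel" by measurable
qed

lemma L2_Minkowski:
  assumes "f \<in> L2" "g \<in> L2"
  shows "sqrt (LINT x|lborel. (norm (f x + g x))\<^sup>2)
    \<le> sqrt (LINT x|lborel. (norm (f x))\<^sup>2) + sqrt (LINT x|lborel. (norm (g x))\<^sup>2)"
proof (rule field_le_epsilon)
  fix \<delta> :: real assume "\<delta> > 0"
  let ?a = "LINT x|lborel. (norm (f x + g x))\<^sup>2"
  let ?b = "LINT x|lborel. (norm (f x))\<^sup>2" and ?c = "LINT x|lborel. (norm (g x))\<^sup>2"
  \<comment> \<open>The optimal weights are the L^2 norms themselves; adding \<delta>/2 keeps them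
    positive when a norm is 0.\<close>
  define \<beta> \<gamma> where "\<beta> = sqrt ?b + \<delta> / 2" and "\<gamma> = sqrt ?c + \<delta> / 2"
  have pos: "\<beta> > 0" "\<gamma> > 0" using \<open>\<delta> > 0\<close> by (auto simp: \<beta>_def \<gamma>_def intro!: add_nonneg_pos)
  have "?b \<le> \<beta>\<^sup>2" "?c \<le> \<gamma>\<^sup>2"
    using \<open>\<delta> > 0\<close> pos by (auto intro!: sqrt_le_D simp: \<beta>_def \<gamma>_def)
  then have bc: "?b / \<beta> \<le> \<beta>" "?c / \<gamma> \<le> \<gamma>"
    using pos by (auto simp: field_simps power2_eq_square)
  have "?a \<le> (LINT x|lborel. (\<beta> + \<gamma>) * ((norm (f x))\<^sup>2 / \<beta> + (norm (g x))\<^sup>2 / \<gamma>))"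
    by (intro integral_mono integrable_mult_right Bochner_Integration.integrable_add
        integrable_divide L2_integrable L2_add assms norm_add_power2_le pos)
  also have "\<dots> = (\<beta> + \<gamma>) * (?b / \<beta> + ?c / \<gamma>)"
    using assms[THEN L2_integrable] by simp
  also have "\<dots> \<le> (\<beta> + \<gamma>) * (\<beta> + \<gamma>)"
    using bc pos by (intro mult_left_mono) auto
  finally have "sqrt ?a \<le> \<beta> + \<gamma>"
    using pos by (intro real_le_lsqrt) (auto simp: power2_eq_square)
  then show "sqrt ?a \<le> sqrt ?b + sqrt ?c + \<delta>" by (simp add: \<beta>_def \<gamma>_def)
qed

section \<open>Functions determined by their integrals over boxes or against test functions\<close>

lemma L2_set_integrable_box:
  assumes "f \<in> L2"
  shows "set_integrable lborel (box a b) f"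
  unfolding set_integrable_def
proof (rule Bochner_Integration.integrable_bound)
  note [measurable] = assms[THEN L2_measurable]
  have "emeasure lborel (box a b :: (real^3) set) < \<infinity>"
    by (intro emeasure_bounded_finite) auto
  then show "integrable lborel (\<lambda>x. (norm (f x))\<^sup>2 + indicator (box a b) x)"
    using L2_integrable[OF assms] by (intro Bochner_Integration.integrable_add) auto
  show "(\<lambda>x. indicator (box a b) x *\<^sub>R f x) \<in> borel_measurable lborel" by measurable
  show "AE x in lborel. norm (indicator (box a b) x *\<^sub>R f x) \<le> norm ((norm (f x))\<^sup>2 + indicator (box a b) x :: real)"
  proof (intro AE_I2)
    fix x
    have "norm (f x) \<le> (norm (f x))\<^sup>2 + 1"
      using sum_squares_bound[of "norm (f x)" 1] norm_ge_zero[of "f x"] by (simp del: norm_ge_zero)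
    then show "norm (indicator (box a b) x *\<^sub>R f x) \<le> norm ((norm (f x))\<^sup>2 + indicator (box a b) x :: real)"
      by (auto simp: indicator_def)
  qed
qed

text \<open>Lebesgue differentiation: for almost every \<open>x\<close> the averages over the cubes
  with lower corner \<open>x\<close> and side h converge to \<open>f x\<close> as h tends to 0, and
  here all of them are 0.\<close>

lemma AE_eq_0_if_integral_box_eq_0:
  fixes f :: "'a::euclidean_space \<Rightarrow> 'b::euclidean_space"
  assumes int: "\<And>a b. set_integrable lborel (box a b) f"
    and zero: "\<And>a b. (LINT x:box a b|lborel. f x) = 0"
  shows "AE x in lborel. f x = 0"
proof -
  have "f integrable_on cbox a b" for a b
    using set_borel_integral_eq_integral(1)[OF int] by (simp add: integrable_on_open_interval)
  then obtain N where N: "negligible N"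
    "\<And>x e. x \<notin> N \<Longrightarrow> 0 < e \<Longrightarrow> \<exists>d>0. \<forall>h. 0 < h \<and> h < d \<longrightarrow>
      norm (integral (cbox x (x + h *\<^sub>R One)) f /\<^sub>R h ^ DIM('a) - f x) < e"
    by (rule integrable_ccontinuous_explicit) blast
  have "integral (cbox a b) f = 0" for a b
    using set_borel_integral_eq_integral(2)[OF int] zero by (simp add: integral_open_interval)
  then have small: "norm (f x) < e" if x: "x \<notin> N" and e: "0 < e" for x e
  proof -
    from N(2)[OF x e] obtain d where d: "d > 0"
      "\<forall>h. 0 < h \<and> h < d \<longrightarrow> norm (integral (cbox x (x + h *\<^sub>R One)) f /\<^sub>R h ^ DIM('a) - f x) < e"
      by blast
    then show ?thesis using d(2)[rule_format, of "d / 2"] \<open>\<And>a b. integral (cbox a b) f = 0\<close> by simp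
  qed
  \<comment> \<open>If \<open>f x\<close> were nonzero, \<open>small\<close> at
    \<open>e = norm (f x)\<close> would read \<open>norm (f x) < norm (f x)\<close>.\<close>
  have zero: "f x = 0" if "x \<notin> N" for x
    using small[OF that, of "norm (f x)"] by auto
  have "AE x in lebesgue. x \<notin> N"
    using N(1) by (intro AE_not_in) (simp add: negligible_iff_null_sets)
  then have "AE x in lebesgue. f x = 0"
    by eventually_elim (rule zero)
  then show ?thesis by (simp add: AE_completion_iff)
qed

text \<open>Testing against smooth approximations of the indicators of boxes shows that all box
  averages of \<open>f\<close> vanish; Lebesgue differentiation finishes.\<close>

lemma fundamental_lemma_calculus_of_variations:
  fixes f :: "real^3 \<Rightarrow> complex"
  assumes f: "f \<in> L2"
    and zero: "\<And>\<phi>. test_function \<phi> \<Longrightarrow> (LINT x|lborel. f x * \<phi> x) = 0"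
  shows "AE x in lborel. f x = 0"
proof (rule AE_eq_0_if_integral_box_eq_0)
  note [measurable] = L2_measurable[OF f]
  show int: "set_integrable lborel (box a b) f" for a b
    using f by (rule L2_set_integrable_box)
  fix a b
  obtain \<phi> where \<phi>: "\<And>n. test_function (\<lambda>x. complex_of_real (\<phi> n x))"
    "\<And>n x. 0 \<le> \<phi> n x \<and> \<phi> n x \<le> 1"
    "\<And>x. (\<lambda>n. \<phi> n x) \<longlonglongrightarrow> indicator (box a b) x"
    "\<And>n x. x \<notin> box a b \<Longrightarrow> \<phi> n x = (0::real)"
    using box_indicator_approx[of a b] by blast
  have [measurable]: "(\<lambda>x. complex_of_real (\<phi> n x)) \<in> borel_measurable borel" for n
    by (intro smooth_borel_measurable test_function_smooth \<phi>)
  have "(\<lambda>n. LINT x|lborel. f x * complex_of_real (\<phi> n x)) \<longlonglongrightarrow> (LINT x|lborel. indicator (box a b) x *\<^sub>R f x)"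
  proof (rule integral_dominated_convergence)
    show "integrable lborel (\<lambda>x. norm (indicator (box a b) x *\<^sub>R f x))"
      using int[of a b] unfolding set_integrable_def by (rule integrable_norm)
    show "AE x in lborel. (\<lambda>n. f x * complex_of_real (\<phi> n x)) \<longlonglongrightarrow> indicator (box a b) x *\<^sub>R f x"
    proof (intro AE_I2)
      fix x
      have "(\<lambda>n. f x * complex_of_real (\<phi> n x)) \<longlonglongrightarrow> f x * complex_of_real (indicator (box a b) x)"
        by (rule tendsto_mult[OF tendsto_const tendsto_of_real[OF \<phi>(3)]])
      then show "(\<lambda>n. f x * complex_of_real (\<phi> n x)) \<longlonglongrightarrow> indicator (box a b) x *\<^sub>R f x"
        by (simp add: scaleR_conv_of_real mult.commute)
    qed
    show "AE x in lborel. norm (f x * complex_of_real (\<phi> n x)) \<le> norm (indicator (box a b) x *\<^sub>R f x)" for n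
    proof (intro AE_I2)
      fix x
      show "norm (f x * complex_of_real (\<phi> n x)) \<le> norm (indicator (box a b) x *\<^sub>R f x)"
      proof (cases "x \<in> box a b")
        case True
        have "norm (f x) * \<phi> n x \<le> norm (f x) * 1"
          using \<phi>(2)[of n x] by (intro mult_left_mono) auto
        then show ?thesis using True \<phi>(2)[of n x] by (simp add: norm_mult)
      qed (simp add: \<phi>(4))
    qed
  qed measurable
  then have "(\<lambda>n::nat. 0) \<longlonglongrightarrow> (LINT x|lborel. indicator (box a b) x *\<^sub>R f x)"
    unfolding zero[OF \<phi>(1)] .
  then show "(LINT x:box a b|lborel. f x) = 0"
    unfolding set_lebesgue_integral_def by (simp only: LIMSEQ_const_iff)
qed

lemma L2_integral_diff_mult:
  fixes f g h :: "real^3 \<Rightarrow> 'b::{euclidean_space, real_normed_algebra}"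
  assumes "f \<in> L2" "g \<in> L2" "h \<in> L2"
  shows "(LINT x|lborel. (f x - g x) * h x) = (LINT x|lborel. f x * h x) - (LINT x|lborel. g x * h x)"
  unfolding left_diff_distrib
  by (intro Bochner_Integration.integral_diff L2_integrable_mult assms)

section \<open>Weak gradients\<close>

lemma weak_gradient_unique:
  assumes "weak_gradient u G" "weak_gradient u G'" "G \<in> L2" "G' \<in> L2"
  shows "AE x in lborel. G x = G' x"
proof -
  have "AE x in lborel. G x $ i - G' x $ i = 0" for i
  proof (rule fundamental_lemma_calculus_of_variations)
    show "(\<lambda>x. G x $ i - G' x $ i) \<in> L2"
      using assms by (intro L2_diff L2_vec_nth)
    fix \<phi> assume \<phi>: "test_function \<phi>"
    have "(LINT x|lborel. G x $ i * \<phi> x) = (LINT x|lborel. G' x $ i * \<phi> x)"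
      using assms(1)[unfolded weak_gradient_def, rule_format, OF \<phi>, of i]
        assms(2)[unfolded weak_gradient_def, rule_format, OF \<phi>, of i] by simp
    then show "(LINT x|lborel. (G x $ i - G' x $ i) * \<phi> x) = 0"
      by (subst L2_integral_diff_mult[OF L2_vec_nth[OF assms(3)] L2_vec_nth[OF assms(4)] test_function_L2[OF \<phi>]]) simp
  qed
  then have "AE x in lborel. \<forall>i. G x $ i - G' x $ i = 0"
    by (subst AE_all_countable) auto
  then show ?thesis by (auto simp: vec_eq_iff)
qed

lemma weak_gradient_diff:
  assumes "weak_gradient u G" "weak_gradient v G'" "u \<in> L2" "v \<in> L2" "G \<in> L2" "G' \<in> L2"
  shows "weak_gradient (\<lambda>x. u x - v x) (\<lambda>x. G x - G' x)"
  unfolding weak_gradient_def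
proof (intro allI impI)
  fix i \<phi> assume \<phi>: "test_function \<phi>"
  note L2 = test_function_L2[OF \<phi>] test_function_L2[OF test_function_pdiff[OF \<phi>]]
  have "(LINT x|lborel. (u x - v x) * pdiff i \<phi> x) =
      (LINT x|lborel. u x * pdiff i \<phi> x) - (LINT x|lborel. v x * pdiff i \<phi> x)"
    by (rule L2_integral_diff_mult[OF assms(3,4) L2(2)])
  also have "\<dots> = - ((LINT x|lborel. G x $ i * \<phi> x) - (LINT x|lborel. G' x $ i * \<phi> x))"
    using assms \<phi> by (simp add: weak_gradient_def)
  also have "\<dots> = - (LINT x|lborel. (G x - G' x) $ i * \<phi> x)"
    by (simp add: L2_integral_diff_mult[OF L2_vec_nth[OF assms(5)] L2_vec_nth[OF assms(6)] L2(1)])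
  finally show "(LINT x|lborel. (u x - v x) * pdiff i \<phi> x) = - (LINT x|lborel. (G x - G' x) $ i * \<phi> x)" .
qed

lemma H1_grad:
  assumes "u \<in> H1"
  shows "u \<in> L2" "grad u \<in> L2" "weak_gradient u (grad u)"
proof -
  have "\<exists>G. G \<in> L2 \<and> weak_gradient u G" using assms by (auto simp: H1_def)
  from someI_ex[OF this] show "grad u \<in> L2" "weak_gradient u (grad u)"
    by (auto simp: grad_def)
  show "u \<in> L2" using assms by (simp add: H1_def)
qed

text \<open>\<open>kinetic\<close> is defined through the choice \<open>grad\<close>; by almost
  everywhere uniqueness any explicit L^2 weak gradient computes it. The formulas for differences and
  dilates are obtained this way.\<close>

lemma kinetic_eq:
  assumes "G \<in> L2" "weak_gradient u G"
  shows "kinetic u = (LINT x|lborel. (norm (G x))\<^sup>2)"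
proof -
  have "\<exists>G. G \<in> L2 \<and> weak_gradient u G" using assms by blast
  from someI_ex[OF this] have grad: "grad u \<in> L2" "weak_gradient u (grad u)"
    by (auto simp: grad_def)
  note [measurable] = L2_measurable[OF grad(1)] L2_measurable[OF assms(1)]
  have "AE x in lborel. grad u x = G x"
    using grad assms by (intro weak_gradient_unique)
  then show ?thesis unfolding kinetic_def
    by (intro integral_cong_AE) auto
qed

lemma kinetic_nonneg: "kinetic u \<ge> 0"
  by (simp add: kinetic_def)

lemma mass_nonneg: "mass u \<ge> 0"
  by (simp add: mass_def)

lemma kinetic_diff:
  assumes "u \<in> H1" "v \<in> H1"
  shows "kinetic (\<lambda>x. u x - v x) = (LINT x|lborel. (norm (grad u x - grad v x))\<^sup>2)"
  by (rule kinetic_eq[OF L2_diff weak_gradient_diff]; intro H1_grad assms)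

lemma kinetic_minus_commute:
  assumes "u \<in> H1" "v \<in> H1"
  shows "kinetic (\<lambda>x. u x - v x) = kinetic (\<lambda>x. v x - u x)"
  using assms by (simp add: kinetic_diff norm_minus_commute)

lemma sqrt_kinetic_triangle:
  assumes "u \<in> H1" "v \<in> H1"
  shows "sqrt (kinetic u) \<le> sqrt (kinetic (\<lambda>x. u x - v x)) + sqrt (kinetic v)"
  using L2_Minkowski[OF L2_diff[OF H1_grad(2)[OF assms(1)] H1_grad(2)[OF assms(2)]] H1_grad(2)[OF assms(2)]]
  by (simp add: kinetic_diff[OF assms]) (simp add: kinetic_def)

lemma sqrt_kinetic_diff_le:
  assumes "u \<in> H1" "v \<in> H1"
  shows "\<bar>sqrt (kinetic u) - sqrt (kinetic v)\<bar> \<le> H1_dist u v"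
proof -
  have "\<bar>sqrt (kinetic u) - sqrt (kinetic v)\<bar> \<le> sqrt (kinetic (\<lambda>x. u x - v x))"
    using sqrt_kinetic_triangle[OF assms] sqrt_kinetic_triangle[OF assms(2,1)]
      kinetic_minus_commute[OF assms] by (simp add: abs_le_iff)
  also have "\<dots> \<le> H1_dist u v"
    unfolding H1_dist_def using mass_nonneg by (intro real_sqrt_le_mono) simp
  finally show ?thesis .
qed

text \<open>The square root of \<open>kinetic\<close> is a seminorm dominated by the H^1 norm, hence
  1-Lipschitz for \<open>H1_dist\<close>; squaring preserves continuity.\<close>

lemma continuous_on_kinetic:
  assumes "H1_continuous_on I g"
  shows "continuous_on I (\<lambda>t. kinetic (g t))"
proof -
  have g: "g t \<in> H1" if "t \<in> I" for t
    using assms that by (simp add: H1_continuous_on_def)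
  have "continuous_on I (\<lambda>t. sqrt (kinetic (g t)))"
    unfolding continuous_on_def
  proof
    fix s assume s: "s \<in> I"
    have "((\<lambda>t. H1_dist (g t) (g s)) \<longlongrightarrow> 0) (at s within I)"
      using assms s by (simp add: H1_continuous_on_def)
    then have "((\<lambda>t. sqrt (kinetic (g t)) - sqrt (kinetic (g s))) \<longlongrightarrow> 0) (at s within I)"
      by (rule Lim_null_comparison[rotated])
         (use g s sqrt_kinetic_diff_le in \<open>auto simp: eventually_at_filter\<close>)
    then show "((\<lambda>t. sqrt (kinetic (g t))) \<longlongrightarrow> sqrt (kinetic (g s))) (at s within I)"
      by (simp add: LIM_zero_iff)
  qed
  then have "continuous_on I (\<lambda>t. (sqrt (kinetic (g t)))\<^sup>2)"
    by (rule continuous_on_power)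
  then show ?thesis by (simp add: kinetic_nonneg)
qed

text \<open>The predicate \<open>weak_gradient u\<close> sees \<open>u\<close> only through
  integrals. For almost everywhere equal functions the predicates coincide, and so do the choices
  made by \<open>SOME\<close>.\<close>

lemma kinetic_cong_AE:
  assumes "AE x in lborel. u x = v x" "u \<in> L2" "v \<in> L2"
  shows "kinetic u = kinetic v"
proof -
  note [measurable] = assms(2,3)[THEN L2_measurable]
  have "(LINT x|lborel. u x * pdiff i \<phi> x) = (LINT x|lborel. v x * pdiff i \<phi> x)" if "test_function \<phi>" for i \<phi>
  proof -
    have [measurable]: "pdiff i \<phi> \<in> borel_measurable borel"
      using that by (intro smooth_borel_measurable smooth_pdiff test_function_smooth)
    show ?thesis by (rule integral_cong_AE) (use assms(1) in auto)
  qed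
  then have "weak_gradient u = weak_gradient v"
    by (intro ext) (simp add: weak_gradient_def)
  then show ?thesis by (simp add: kinetic_def grad_def)
qed

section \<open>Dilations\<close>

lemma measurable_scaled_iff:
  fixes f :: "'a::euclidean_space \<Rightarrow> 'b::topological_space"
  assumes "a \<noteq> 0"
  shows "(\<lambda>x. f (a *\<^sub>R x)) \<in> borel_measurable borel \<longleftrightarrow> f \<in> borel_measurable borel"
proof
  assume "(\<lambda>x. f (a *\<^sub>R x)) \<in> borel_measurable borel"
  from measurable_compose[OF _ this, of "\<lambda>x. (1 / a) *\<^sub>R x" borel]
  show "f \<in> borel_measurable borel" using assms by simp
next
  assume [measurable]: "f \<in> borel_measurable borel"
  show "(\<lambda>x. f (a *\<^sub>R x)) \<in> borel_measurable borel" by measurable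
qed

lemma integrable_scaled:
  fixes f :: "'a::euclidean_space \<Rightarrow> 'b::{banach, second_countable_topology}"
  assumes "integrable lborel f" "a \<noteq> 0"
  shows "integrable lborel (\<lambda>x. f (a *\<^sub>R x))"
proof -
  have [measurable]: "f \<in> borel_measurable borel"
    using borel_measurable_integrable[OF assms(1)] by simp
  have "integrable (density (distr lborel borel (\<lambda>x::'a. 0 + a *\<^sub>R x)) (\<lambda>_. ennreal (\<bar>a\<bar> ^ DIM('a)))) f"
    using assms lborel_affine[of a "0::'a"] by simp
  then have "integrable lborel (\<lambda>x. \<bar>a\<bar> ^ DIM('a) *\<^sub>R f (a *\<^sub>R x))"
    by (subst (asm) integrable_density) (auto simp: integrable_distr_eq)
  then have "integrable lborel (\<lambda>x. (1 / \<bar>a\<bar> ^ DIM('a)) *\<^sub>R \<bar>a\<bar> ^ DIM('a) *\<^sub>R f (a *\<^sub>R x))"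
    by (rule integrable_scaleR_right)
  then show ?thesis using assms(2) by simp
qed

lemma integrable_scaled_iff:
  fixes f :: "'a::euclidean_space \<Rightarrow> 'b::{banach, second_countable_topology}"
  assumes "a \<noteq> 0"
  shows "integrable lborel (\<lambda>x. f (a *\<^sub>R x)) \<longleftrightarrow> integrable lborel f"
  using integrable_scaled[of f a] integrable_scaled[of "\<lambda>x. f (a *\<^sub>R x)" "1 / a"] assms by auto

text \<open>A homothety preserves integrability, so for a non-integrable \<open>f\<close> both
  integrals have the default value 0. The quartic and dipolar integrals can thus be rescaled as they
  stand.\<close>

lemma integral_scaled:
  fixes f :: "'a::euclidean_space \<Rightarrow> 'b::{banach, second_countable_topology}"
  assumes "a > 0"
  shows "(LINT x|lborel. f (a *\<^sub>R x)) = (1 / a ^ DIM('a)) *\<^sub>R (LINT x|lborel. f x)"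
proof (cases "integrable lborel f")
  case True
  then have [measurable]: "f \<in> borel_measurable borel"
    using borel_measurable_integrable by force
  have "(LINT x|lborel. f x) =
      (LINT x|density (distr lborel borel (\<lambda>x::'a. 0 + a *\<^sub>R x)) (\<lambda>_. ennreal (\<bar>a\<bar> ^ DIM('a))). f x)"
    using assms lborel_affine[of a "0::'a"] by simp
  also have "\<dots> = a ^ DIM('a) *\<^sub>R (LINT x|lborel. f (a *\<^sub>R x))"
    using assms by (subst integral_density) (auto simp: integral_distr)
  finally show ?thesis using assms by simp
next
  case False
  then show ?thesis
    using assms integrable_scaled_iff[of a f] by (simp add: not_integrable_integral_eq)
qed

lemma integral_scaled3:
  fixes f :: "real^3 \<Rightarrow> 'b::{banach, second_countable_topology}"
  assumes "a > 0"
  shows "(LINT x|lborel. f (a *\<^sub>R x)) = (1 / a ^ 3) *\<^sub>R (LINT x|lborel. f x)"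
  using integral_scaled[OF assms, of f] by simp

text \<open>A quartic expression in \<open>dilate a u\<close> carries the fourth power of a^(3/2),
  that is a^6, and the Jacobian removes a^3.\<close>

lemma integral_scaled_power6:
  fixes f :: "real^3 \<Rightarrow> real"
  assumes "a > 0"
  shows "(LINT x|lborel. a ^ 6 * f (a *\<^sub>R x)) = a ^ 3 * (LINT x|lborel. f x)"
proof -
  have "a ^ 3 * (LINT x|lborel. f (a *\<^sub>R x)) = (LINT x|lborel. f x)"
    using integral_scaled3[OF assms, of f] assms by simp
  moreover have "a ^ 6 = a ^ 3 * a ^ 3" by (simp flip: power_add)
  ultimately show ?thesis by (simp only: integral_mult_right_zero mult.assoc)
qed

text \<open>The factor makes \<open>dilate t\<close> an isometry of \<open>L\<^sup>2(\<real>\<^sup>3)\<close>.\<close>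

definition dilate :: "real \<Rightarrow> (real^3 \<Rightarrow> 'b::real_normed_vector) \<Rightarrow> real^3 \<Rightarrow> 'b" where
  "dilate t f x = sqrt (t ^ 3) *\<^sub>R f (t *\<^sub>R x)"

lemma norm_dilate_power2: "t > 0 \<Longrightarrow> (norm (dilate t f x))\<^sup>2 = t ^ 3 * (norm (f (t *\<^sub>R x)))\<^sup>2"
  by (simp add: dilate_def power_mult_distrib)

lemma L2_dilate:
  assumes "f \<in> L2" "t > 0"
  shows "dilate t f \<in> L2"
proof -
  have "dilate t f \<in> borel_measurable borel"
    unfolding dilate_def using assms L2_measurable measurable_scaled_iff[of t f]
    by (auto intro!: borel_measurable_scaleR)
  then show ?thesis
    using integrable_scaled[OF L2_integrable[OF assms(1)], of t] assms(2)
    by (simp add: L2_def norm_dilate_power2)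
qed

lemma integral_norm_dilate:
  assumes "t > 0"
  shows "(LINT x|lborel. (norm (dilate t f x))\<^sup>2) = (LINT x|lborel. (norm (f x))\<^sup>2)"
  using integral_scaled3[OF assms, of "\<lambda>x. (norm (f x))\<^sup>2"] assms
  by (simp add: norm_dilate_power2)

lemma mass_dilate: "t > 0 \<Longrightarrow> mass (dilate t u) = mass u"
  by (simp add: mass_def integral_norm_dilate)

text \<open>A change of variables moves the dilation onto the test function, giving \<psi>(x) =
  \<phi>(x/t); the factor t of the gradient comes from the chain rule for \<phi> in terms of
  \<psi>.\<close>

lemma weak_gradient_dilate:
  assumes "weak_gradient u G" "t > 0"
  shows "weak_gradient (dilate t u) (\<lambda>x. t *\<^sub>R dilate t G x)"
  unfolding weak_gradient_def
proof (intro allI impI)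
  fix i \<phi> assume \<phi>: "test_function \<phi>"
  define \<psi> where "\<psi> x = \<phi> ((1 / t) *\<^sub>R x)" for x
  have \<psi>: "test_function \<psi>"
    unfolding \<psi>_def using \<phi> assms(2) by (intro test_function_scaled) auto
  have d\<psi>: "pdiff i \<phi> x = t *\<^sub>R pdiff i \<psi> (t *\<^sub>R x)" for x
  proof -
    have "pdiff i \<psi> (t *\<^sub>R x) = (1 / t) *\<^sub>R pdiff i \<phi> ((1 / t) *\<^sub>R t *\<^sub>R x)"
      unfolding \<psi>_def by (rule pdiff_scaled) (intro smooth_differentiable test_function_smooth \<phi>)
    then show ?thesis using assms(2) by simp
  qed
  have "(LINT x|lborel. dilate t u x * pdiff i \<phi> x) =
      (LINT x|lborel. (sqrt (t ^ 3) * t) *\<^sub>R (u (t *\<^sub>R x) * pdiff i \<psi> (t *\<^sub>R x)))"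
    by (simp add: dilate_def d\<psi> mult.commute)
  also have "\<dots> = (sqrt (t ^ 3) * t / t ^ 3) *\<^sub>R (LINT x|lborel. u x * pdiff i \<psi> x)"
    using integral_scaled3[OF assms(2), of "\<lambda>x. u x * pdiff i \<psi> x"] by simp
  also have "(LINT x|lborel. u x * pdiff i \<psi> x) = - (LINT x|lborel. G x $ i * \<psi> x)"
    using assms(1) \<psi> by (simp add: weak_gradient_def)
  also have "(sqrt (t ^ 3) * t / t ^ 3) *\<^sub>R - (LINT x|lborel. G x $ i * \<psi> x) =
      - (LINT x|lborel. (sqrt (t ^ 3) * t) *\<^sub>R (G (t *\<^sub>R x) $ i * \<psi> (t *\<^sub>R x)))"
    using integral_scaled3[OF assms(2), of "\<lambda>x. G x $ i * \<psi> x"] by simp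
  also have "\<dots> = - (LINT x|lborel. (t *\<^sub>R dilate t G x) $ i * \<phi> x)"
    using assms(2) by (simp add: dilate_def \<psi>_def mult.commute)
  finally show "(LINT x|lborel. dilate t u x * pdiff i \<phi> x) = - (LINT x|lborel. (t *\<^sub>R dilate t G x) $ i * \<phi> x)" .
qed

lemma H1_dilate:
  assumes "u \<in> H1" "t > 0"
  shows "dilate t u \<in> H1"
  using L2_dilate[OF H1_grad(1)[OF assms(1)] assms(2)]
    weak_gradient_dilate[OF H1_grad(3)[OF assms(1)] assms(2)]
    L2_scaleR[OF L2_dilate[OF H1_grad(2)[OF assms(1)] assms(2)], of t]
  unfolding H1_def by blast

lemma kinetic_dilate:
  assumes "u \<in> H1" "t > 0"
  shows "kinetic (dilate t u) = t\<^sup>2 * kinetic u"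
proof -
  have "kinetic (dilate t u) = (LINT x|lborel. (norm (t *\<^sub>R dilate t (grad u) x))\<^sup>2)"
    by (rule kinetic_eq[OF L2_scaleR[OF L2_dilate] weak_gradient_dilate]; intro H1_grad assms)
  then show ?thesis
    using integral_norm_dilate[OF assms(2), of "grad u"]
    by (simp add: power_mult_distrib kinetic_def)
qed

lemma kinetic_dilate_diff:
  assumes "u \<in> H1" "s > 0" "t > 0"
  shows "kinetic (\<lambda>x. dilate t u x - dilate s u x) =
    (LINT x|lborel. (norm (t *\<^sub>R dilate t (grad u) x - s *\<^sub>R dilate s (grad u) x))\<^sup>2)"
  by (rule kinetic_eq[OF L2_diff[OF L2_scaleR[OF L2_dilate] L2_scaleR[OF L2_dilate]]
        weak_gradient_diff[OF weak_gradient_dilate weak_gradient_dilate]];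
      intro L2_scaleR L2_dilate H1_grad assms)

section \<open>The dipolar operator under dilations\<close>

text \<open>The factor \<open>a ^ 3\<close> is the one carried by the density
  \<open>(norm (dilate a u x))\<^sup>2\<close>, and it cancels the Jacobian exactly.\<close>

lemma fourier_scaled:
  assumes "a > 0"
  shows "fourier (\<lambda>x. complex_of_real (a ^ 3 * f (a *\<^sub>R x))) \<xi> =
    fourier (\<lambda>x. complex_of_real (f x)) ((1 / a) *\<^sub>R \<xi>)"
proof -
  let ?F = "\<lambda>x. cis (- (x \<bullet> ((1 / a) *\<^sub>R \<xi>))) * complex_of_real (f x)"
  have "fourier (\<lambda>x. complex_of_real (a ^ 3 * f (a *\<^sub>R x))) \<xi> = (LINT x|lborel. a ^ 3 *\<^sub>R ?F (a *\<^sub>R x))"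
    using assms by (simp add: fourier_def scaleR_conv_of_real[where 'a=complex] mult_ac)
  also have "\<dots> = (LINT x|lborel. ?F x)"
    unfolding integral_scaleR_right integral_scaled3[OF assms, of ?F] using assms by simp
  finally show ?thesis by (simp add: fourier_def)
qed

lemma inv_fourier_scaled:
  assumes "a > 0"
  shows "inv_fourier (\<lambda>x. \<phi> ((1 / a) *\<^sub>R x)) \<xi> = a ^ 3 *\<^sub>R inv_fourier \<phi> (a *\<^sub>R \<xi>)"
proof -
  let ?F = "\<lambda>x. cis (x \<bullet> (a *\<^sub>R \<xi>)) * \<phi> x"
  have "(LINT x|lborel. cis (x \<bullet> \<xi>) * \<phi> ((1 / a) *\<^sub>R x)) = (LINT x|lborel. ?F ((1 / a) *\<^sub>R x))"
    using assms by simp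
  also have "\<dots> = a ^ 3 *\<^sub>R (LINT x|lborel. ?F x)"
    using assms by (subst integral_scaled3) (auto simp: power_one_over)
  finally show ?thesis by (simp add: inv_fourier_def scaleR_conv_of_real[where 'a=complex])
qed

lemma dipole_symbol_scaled: "a \<noteq> 0 \<Longrightarrow> dipole_symbol (a *\<^sub>R \<xi>) = dipole_symbol \<xi>"
proof -
  assume "a \<noteq> 0"
  have "2 * (a * \<xi> $ 3)\<^sup>2 - (a * \<xi> $ 1)\<^sup>2 - (a * \<xi> $ 2)\<^sup>2
      = a\<^sup>2 * (2 * (\<xi> $ 3)\<^sup>2 - (\<xi> $ 1)\<^sup>2 - (\<xi> $ 2)\<^sup>2)"
    by (simp add: power_mult_distrib algebra_simps)
  then show ?thesis
    using \<open>a \<noteq> 0\<close> by (simp add: dipole_symbol_def power_mult_distrib)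
qed

lemma L2_scaled:
  assumes "f \<in> L2" "a > 0"
  shows "(\<lambda>x. c *\<^sub>R f (a *\<^sub>R x)) \<in> L2"
  using L2_scaleR[OF L2_dilate[OF assms], of "c / sqrt (a ^ 3)"] assms(2)
  by (simp add: dilate_def)

text \<open>The space integral is rewritten with \<psi>(x) = \<phi>(x/a), where the identity for
  \<open>f\<close> and \<open>g\<close> applies. On the Fourier side \<xi> is replaced by \<xi>/a:
  the symbol does not change, and the Jacobian a^-3 cancels the a^3 from
  \<open>inv_fourier_scaled\<close>.\<close>

lemma is_dipole_conv_scaled:
  assumes "is_dipole_conv f g" "a > 0"
  shows "is_dipole_conv (\<lambda>x. a ^ 3 * f (a *\<^sub>R x)) (\<lambda>x. a ^ 3 * g (a *\<^sub>R x))"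
  unfolding is_dipole_conv_def
proof (intro conjI allI impI)
  show "integrable lborel (\<lambda>x. a ^ 3 * f (a *\<^sub>R x))"
    using assms by (auto simp: is_dipole_conv_def integrable_scaled_iff)
  show "(\<lambda>x. a ^ 3 * g (a *\<^sub>R x)) \<in> L2"
    using L2_scaled[of g a "a ^ 3"] assms by (simp add: is_dipole_conv_def)
  fix \<phi> assume \<phi>: "schwartz \<phi>"
  define \<psi> where "\<psi> x = \<phi> ((1 / a) *\<^sub>R x)" for x
  have \<psi>: "schwartz \<psi>" unfolding \<psi>_def using \<phi> assms(2) by (intro schwartz_scaled) auto
  let ?f = "fourier (\<lambda>x. complex_of_real (f x))"
  let ?G = "\<lambda>x. complex_of_real (g x) * \<psi> x"
  let ?H = "\<lambda>\<xi>. complex_of_real (dipole_symbol \<xi>) * ?f \<xi> * inv_fourier \<psi> \<xi>"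
  have "(LINT x|lborel. complex_of_real (a ^ 3 * g (a *\<^sub>R x)) * \<phi> x) = (LINT x|lborel. a ^ 3 *\<^sub>R ?G (a *\<^sub>R x))"
    using assms(2) by (simp add: \<psi>_def scaleR_conv_of_real[where 'a=complex] mult_ac)
  also have "\<dots> = (LINT x|lborel. ?G x)"
    unfolding integral_scaleR_right integral_scaled3[OF assms(2), of ?G] using assms(2) by simp
  also have "\<dots> = (LINT \<xi>|lborel. ?H \<xi>)"
    using assms(1) \<psi> by (simp add: is_dipole_conv_def)
  also have "\<dots> = (LINT \<xi>|lborel. (1 / a ^ 3) *\<^sub>R ?H ((1 / a) *\<^sub>R \<xi>))"
    unfolding integral_scaleR_right using assms(2)
    by (subst integral_scaled3[of _ ?H]) (auto simp: power_one_over)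
  also have "\<dots> = (LINT \<xi>|lborel. complex_of_real (dipole_symbol \<xi>)
      * fourier (\<lambda>x. complex_of_real (a ^ 3 * f (a *\<^sub>R x))) \<xi> * inv_fourier \<phi> \<xi>)"
    (is "integral\<^sup>L _ ?L = integral\<^sup>L _ ?R")
  proof -
    have "?L \<xi> = ?R \<xi>" for \<xi>
    proof -
      have "inv_fourier \<psi> ((1 / a) *\<^sub>R \<xi>) = a ^ 3 *\<^sub>R inv_fourier \<phi> \<xi>"
        using inv_fourier_scaled[OF assms(2), of \<phi> "(1 / a) *\<^sub>R \<xi>"] assms(2)
        unfolding \<psi>_def by simp
      then show ?thesis
        unfolding fourier_scaled[OF assms(2)] using assms(2)
        by (simp add: dipole_symbol_scaled)
    qed
    then show ?thesis by simp
  qed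
  finally show "(LINT x|lborel. complex_of_real (a ^ 3 * g (a *\<^sub>R x)) * \<phi> x) =
    (LINT \<xi>|lborel. complex_of_real (dipole_symbol \<xi>)
      * fourier (\<lambda>x. complex_of_real (a ^ 3 * f (a *\<^sub>R x))) \<xi> * inv_fourier \<phi> \<xi>)" .
qed

text \<open>Compactly supported test functions are Schwartz functions, and they already separate
  L^2. This makes the choice in \<open>dipole_conv\<close> harmless up to null sets.\<close>

lemma is_dipole_conv_unique:
  assumes "is_dipole_conv f g" "is_dipole_conv f h"
  shows "AE x in lborel. g x = h x"
proof -
  have L2: "(\<lambda>x. complex_of_real (g x)) \<in> L2" "(\<lambda>x. complex_of_real (h x)) \<in> L2"
    using assms by (auto simp: is_dipole_conv_def intro: L2_of_real)
  have "AE x in lborel. complex_of_real (g x) - complex_of_real (h x) = 0"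
  proof (rule fundamental_lemma_calculus_of_variations[OF L2_diff[OF L2]])
    fix \<phi> assume \<phi>: "test_function \<phi>"
    have "(LINT x|lborel. complex_of_real (g x) * \<phi> x) = (LINT x|lborel. complex_of_real (h x) * \<phi> x)"
      using assms test_function_schwartz[OF \<phi>] by (simp add: is_dipole_conv_def)
    then show "(LINT x|lborel. (complex_of_real (g x) - complex_of_real (h x)) * \<phi> x) = 0"
      by (subst L2_integral_diff_mult[OF L2 test_function_L2[OF \<phi>]]) simp
  qed
  then show ?thesis by simp
qed

lemma is_dipole_conv_dipole_conv: "is_dipole_conv f g \<Longrightarrow> is_dipole_conv f (dipole_conv f)"
  using someI[of "is_dipole_conv f" g] by (auto simp: dipole_conv_def)

lemma dipole_conv_measurable: "dipole_conv f \<in> borel_measurable borel"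
proof (cases "\<exists>g. is_dipole_conv f g")
  case True
  then have "is_dipole_conv f (dipole_conv f)" using is_dipole_conv_dipole_conv by blast
  then show ?thesis by (auto simp: is_dipole_conv_def intro: L2_measurable)
qed (simp add: dipole_conv_def)

text \<open>The identity is only almost everywhere because each side involves a choice. If
  \<open>f\<close> admits no dipolar convolution, neither does its rescaling, since rescaling by 1/a
  would recover one for \<open>f\<close>; then both sides are the default 0.\<close>

lemma dipole_conv_scaled:
  assumes "a > 0"
  shows "AE x in lborel. dipole_conv (\<lambda>x. a ^ 3 * f (a *\<^sub>R x)) x = a ^ 3 * dipole_conv f (a *\<^sub>R x)"
proof (cases "\<exists>g. is_dipole_conv f g")
  case True
  then have "is_dipole_conv f (dipole_conv f)" using is_dipole_conv_dipole_conv by blast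
  from is_dipole_conv_scaled[OF this assms] show ?thesis
    by (intro is_dipole_conv_unique[OF is_dipole_conv_dipole_conv])
next
  case False
  have "\<not> is_dipole_conv (\<lambda>x. a ^ 3 * f (a *\<^sub>R x)) g" for g
  proof
    assume "is_dipole_conv (\<lambda>x. a ^ 3 * f (a *\<^sub>R x)) g"
    from is_dipole_conv_scaled[OF this, of "1 / a"] assms have "\<exists>g. is_dipole_conv f g"
      by (auto simp: power_one_over)
    with False show False by contradiction
  qed
  with False show ?thesis by (simp add: dipole_conv_def)
qed

lemma interaction_dilate:
  assumes "u \<in> L2" "t > 0"
  shows "interaction lam1 lam2 (dilate t u) = t ^ 3 * interaction lam1 lam2 u"
proof -
  note [measurable] = L2_measurable[OF assms(1)] dipole_conv_measurable
  let ?K = "dipole_conv (\<lambda>y. (norm (u y))\<^sup>2)"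
  let ?F = "\<lambda>x. ?K x * (norm (u x))\<^sup>2"
  have norm4: "norm (dilate t u x) ^ 4 = t ^ 6 * norm (u (t *\<^sub>R x)) ^ 4" for x
  proof -
    have "norm (dilate t u x) ^ 4 = ((norm (dilate t u x))\<^sup>2)\<^sup>2" by simp
    also have "\<dots> = t ^ 6 * norm (u (t *\<^sub>R x)) ^ 4"
      using assms(2) by (simp only: norm_dilate_power2) (simp add: power_mult_distrib)
    finally show ?thesis .
  qed
  have quartic: "(LINT x|lborel. norm (dilate t u x) ^ 4) = t ^ 3 * (LINT x|lborel. norm (u x) ^ 4)"
    unfolding norm4 by (rule integral_scaled_power6[OF assms(2)])
  \<comment> \<open>The density of the dilate has exactly the form treated by
    \<open>dipole_conv_scaled\<close>; its t^3 and the t^3 of the second factor make up the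
    t^6.\<close>
  have "(LINT x|lborel. dipole_conv (\<lambda>y. (norm (dilate t u y))\<^sup>2) x * (norm (dilate t u x))\<^sup>2) =
      (LINT x|lborel. dipole_conv (\<lambda>y. t ^ 3 * (norm (u (t *\<^sub>R y)))\<^sup>2) x * (t ^ 3 * (norm (u (t *\<^sub>R x)))\<^sup>2))"
    using assms(2) by (simp only: norm_dilate_power2)
  also have "\<dots> = (LINT x|lborel. t ^ 6 * ?F (t *\<^sub>R x))"
  proof (rule integral_cong_AE)
    show "AE x in lborel. dipole_conv (\<lambda>y. t ^ 3 * (norm (u (t *\<^sub>R y)))\<^sup>2) x * (t ^ 3 * (norm (u (t *\<^sub>R x)))\<^sup>2)
        = t ^ 6 * ?F (t *\<^sub>R x)"
      using dipole_conv_scaled[OF assms(2), of "\<lambda>y. (norm (u y))\<^sup>2"]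
    proof eventually_elim
      case (elim x)
      show ?case unfolding elim by (simp flip: power_add)
    qed
  qed measurable
  also have "\<dots> = t ^ 3 * (LINT x|lborel. ?F x)"
    by (rule integral_scaled_power6[OF assms(2)])
  finally show ?thesis by (simp add: interaction_def quartic algebra_simps)
qed

lemma energy_dilate:
  assumes "u \<in> H1" "t > 0"
  shows "energy lam1 lam2 (dilate t u) = t\<^sup>2 / 2 * kinetic u + t ^ 3 / 2 * interaction lam1 lam2 u"
  using assms by (simp add: energy_def kinetic_dilate interaction_dilate H1_grad(1))

section \<open>Strong continuity of dilations\<close>

text \<open>The radial projection onto the ball of radius \<open>M\<close>; the maximum makes it one
  continuous formula with no singularity at 0.\<close>

definition truncate :: "real \<Rightarrow> 'b::real_normed_vector \<Rightarrow> 'b" where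
  "truncate M y = (M / max M (norm y)) *\<^sub>R y"

definition cutoff :: "real \<Rightarrow> 'a::real_normed_vector \<Rightarrow> real" where
  "cutoff R x = max 0 (min 1 (R - norm x))"

lemma truncate_props:
  fixes y :: "'b::real_normed_vector" and S :: "'b set"
  assumes "M > 0"
  shows norm_truncate_le: "norm (truncate M y) \<le> M"
    and norm_truncate_le_norm: "norm (truncate M y) \<le> norm y"
    and truncate_id: "norm y \<le> M \<Longrightarrow> truncate M y = y"
    and continuous_truncate: "continuous_on S (truncate M)"
proof -
  have pos: "max M (norm y) > 0" for y :: 'b using assms by auto
  show "norm (truncate M y) \<le> M" "norm (truncate M y) \<le> norm y"
    using assms pos[of y] by (auto simp: truncate_def field_simps max_def)
  show "norm y \<le> M \<Longrightarrow> truncate M y = y" using assms by (simp add: truncate_def max_def)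
  have "max M (norm y) \<noteq> 0" for y :: 'b using pos[of y] by linarith
  then show "continuous_on S (truncate M)"
    unfolding truncate_def by (intro continuous_intros) auto
qed

lemma cutoff_props:
  shows cutoff_bounds: "0 \<le> cutoff R x" "cutoff R x \<le> 1"
    and cutoff_eq_0: "norm x \<ge> R \<Longrightarrow> cutoff R x = 0"
    and cutoff_eq_1: "norm x \<le> R - 1 \<Longrightarrow> cutoff R x = 1"
    and continuous_cutoff: "continuous_on S (cutoff R)"
  unfolding cutoff_def by (auto intro!: continuous_intros)

text \<open>At a fixed \<open>x\<close> the integrand is eventually exactly 0, namely once n exceeds
  both \<open>norm x\<close> and \<open>norm (f x)\<close>; the shift to \<open>Suc n\<close> pays
  for the unit-wide transition of \<open>cutoff\<close>.\<close>

lemma integral_cutoff_truncate_tendsto: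
  fixes f :: "real^3 \<Rightarrow> 'b::euclidean_space"
  assumes "f \<in> L2"
  shows "(\<lambda>n. LINT x|lborel. (norm (f x - cutoff (real (Suc n)) x *\<^sub>R truncate (real (Suc n)) (f x)))\<^sup>2) \<longlonglongrightarrow> 0"
proof -
  note [measurable] = L2_measurable[OF assms]
  have [measurable]: "truncate (real (Suc n)) \<in> borel_measurable (borel :: 'b measure)"
    "cutoff (real (Suc n)) \<in> borel_measurable (borel :: (real^3) measure)" for n
    by (intro borel_measurable_continuous_onI continuous_truncate continuous_cutoff; simp)+
  have "(\<lambda>n. LINT x|lborel. (norm (f x - cutoff (real (Suc n)) x *\<^sub>R truncate (real (Suc n)) (f x)))\<^sup>2)
      \<longlonglongrightarrow> (LINT x|(lborel :: (real^3) measure). (0::real))"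
  proof (rule integral_dominated_convergence)
    show "integrable lborel (\<lambda>x. 4 * (norm (f x))\<^sup>2)"
      using L2_integrable[OF assms] by simp
    show "AE x in lborel. (\<lambda>n. (norm (f x - cutoff (real (Suc n)) x *\<^sub>R truncate (real (Suc n)) (f x)))\<^sup>2) \<longlonglongrightarrow> 0"
    proof (intro AE_I2 tendsto_eventually)
      fix x
      obtain N :: nat where N: "max (norm x) (norm (f x)) \<le> real N"
        using real_arch_simple by blast
      show "\<forall>\<^sub>F n in sequentially. (norm (f x - cutoff (real (Suc n)) x *\<^sub>R truncate (real (Suc n)) (f x)))\<^sup>2 = 0"
        using eventually_ge_at_top[of N]
      proof eventually_elim
        case (elim n)
        with N have "norm x \<le> real (Suc n) - 1" "norm (f x) \<le> real (Suc n)" by auto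
        then show ?case by (simp add: cutoff_eq_1 truncate_id del: of_nat_Suc)
      qed
    qed
    show "AE x in lborel. norm ((norm (f x - cutoff (real (Suc n)) x *\<^sub>R truncate (real (Suc n)) (f x)))\<^sup>2) \<le> 4 * (norm (f x))\<^sup>2" for n
    proof (intro AE_I2)
      fix x
      have "norm (cutoff (real (Suc n)) x *\<^sub>R truncate (real (Suc n)) (f x)) \<le> 1 * norm (f x)"
        unfolding norm_scaleR
        by (intro mult_mono norm_truncate_le_norm) (use cutoff_bounds[of "real (Suc n)" x] in auto)
      then have "norm (f x - cutoff (real (Suc n)) x *\<^sub>R truncate (real (Suc n)) (f x)) \<le> 2 * norm (f x)"
        using norm_triangle_ineq4[of "f x" "cutoff (real (Suc n)) x *\<^sub>R truncate (real (Suc n)) (f x)"]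
        by linarith
      from power_mono[OF this, of 2]
      show "norm ((norm (f x - cutoff (real (Suc n)) x *\<^sub>R truncate (real (Suc n)) (f x)))\<^sup>2) \<le> 4 * (norm (f x))\<^sup>2"
        by (simp add: power_mult_distrib)
    qed
  qed measurable
  then show ?thesis by simp
qed

text \<open>Nothing controls the size of the approximants \<open>g n\<close>. Applying the same
  truncation and cutoff to them supplies the bound that dominated convergence requires.\<close>

lemma integral_truncate_approx_tendsto:
  fixes f :: "real^3 \<Rightarrow> 'b::euclidean_space"
  assumes f: "f \<in> borel_measurable borel" and "M > 0"
    and g: "\<And>n. continuous_on UNIV (g n)"
    and lim: "AE x in lborel. (\<lambda>n. g n x) \<longlonglongrightarrow> f x"
  shows "(\<lambda>n. LINT x|lborel. (norm (cutoff R x *\<^sub>R truncate M (f x) - cutoff R x *\<^sub>R truncate M (g n x)))\<^sup>2) \<longlonglongrightarrow> 0"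
proof -
  note [measurable] = f
  have [measurable]: "g n \<in> borel_measurable borel" for n
    using g by (intro borel_measurable_continuous_onI)
  have [measurable]: "truncate M \<in> borel_measurable (borel :: 'b measure)"
    "cutoff R \<in> borel_measurable (borel :: (real^3) measure)"
    using \<open>M > 0\<close> by (intro borel_measurable_continuous_onI continuous_truncate continuous_cutoff; simp)+
  have "(\<lambda>n. LINT x|lborel. (norm (cutoff R x *\<^sub>R truncate M (f x) - cutoff R x *\<^sub>R truncate M (g n x)))\<^sup>2)
      \<longlonglongrightarrow> (LINT x|(lborel :: (real^3) measure). (0::real))"
  proof (rule integral_dominated_convergence)
    have "emeasure lborel (cball 0 R :: (real^3) set) < \<infinity>"
      by (intro emeasure_bounded_finite) auto
    then show "integrable lborel (\<lambda>x. (2 * M)\<^sup>2 * indicator (cball 0 R :: (real^3) set) x :: real)"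
      by simp
    show "AE x in lborel. (\<lambda>n. (norm (cutoff R x *\<^sub>R truncate M (f x) - cutoff R x *\<^sub>R truncate M (g n x)))\<^sup>2) \<longlonglongrightarrow> 0"
      using lim
    proof eventually_elim
      case (elim x)
      have "isCont (truncate M) (f x)"
        using continuous_truncate[OF \<open>M > 0\<close>, of "UNIV :: 'b set"] by (simp add: continuous_on_eq_continuous_at)
      then have "(\<lambda>n. truncate M (g n x)) \<longlonglongrightarrow> truncate M (f x)"
        using elim by (rule isCont_tendsto_compose)
      then have "(\<lambda>n. (norm (cutoff R x *\<^sub>R truncate M (f x) - cutoff R x *\<^sub>R truncate M (g n x)))\<^sup>2)
        \<longlonglongrightarrow> (norm (cutoff R x *\<^sub>R truncate M (f x) - cutoff R x *\<^sub>R truncate M (f x)))\<^sup>2"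
        by (intro tendsto_intros)
      then show ?case by simp
    qed
    show "AE x in lborel. norm ((norm (cutoff R x *\<^sub>R truncate M (f x) - cutoff R x *\<^sub>R truncate M (g n x)))\<^sup>2)
      \<le> (2 * M)\<^sup>2 * indicator (cball 0 R) x" for n
    proof (intro AE_I2)
      fix x :: "real^3"
      have le: "norm (cutoff R x *\<^sub>R truncate M y) \<le> 1 * M" for y :: 'b
        unfolding norm_scaleR
        by (intro mult_mono norm_truncate_le) (use cutoff_bounds[of R x] \<open>M > 0\<close> in auto)
      have "norm (cutoff R x *\<^sub>R truncate M (f x) - cutoff R x *\<^sub>R truncate M (g n x)) \<le> 2 * M"
        using norm_triangle_ineq4[of "cutoff R x *\<^sub>R truncate M (f x)" "cutoff R x *\<^sub>R truncate M (g n x)"]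
          le[of "f x"] le[of "g n x"] by linarith
      from power_mono[OF this, of 2]
      show "norm ((norm (cutoff R x *\<^sub>R truncate M (f x) - cutoff R x *\<^sub>R truncate M (g n x)))\<^sup>2)
        \<le> (2 * M)\<^sup>2 * indicator (cball 0 R) x"
        by (cases "norm x \<le> R") (auto simp: cutoff_eq_0)
    qed
  qed measurable
  then show ?thesis by simp
qed

text \<open>Measurability gives continuous functions converging to \<open>f\<close> off a negligible
  set. A level \<open>m\<close> of truncation and cutoff is fixed before the index \<open>n\<close>
  of the approximant is chosen.\<close>

lemma L2_continuous_approx:
  fixes f :: "real^3 \<Rightarrow> 'b::euclidean_space"
  assumes f: "f \<in> L2" and "\<epsilon> > 0"
  obtains h R M where "h \<in> L2" "continuous_on UNIV h" "\<And>x. norm x \<ge> R \<Longrightarrow> h x = 0"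
    "\<And>x. norm (h x) \<le> M" "(LINT x|lborel. (norm (f x - h x))\<^sup>2) < \<epsilon>"
proof -
  note [measurable] = L2_measurable[OF f]
  have "f \<in> borel_measurable lebesgue"
    using L2_measurable[OF f] by (intro measurable_completion) simp
  then have "f measurable_on UNIV"
    by (rule lebesgue_measurable_imp_measurable_on) simp
  then obtain N g where N: "negligible N" and g: "\<And>n. continuous_on UNIV (g n)"
    and lim: "\<And>x. x \<notin> N \<Longrightarrow> (\<lambda>n. g n x) \<longlonglongrightarrow> f x"
    unfolding measurable_on_def by auto
  have "AE x in lebesgue. x \<notin> N"
    using N by (intro AE_not_in) (simp add: negligible_iff_null_sets)
  then have "AE x in lebesgue. (\<lambda>n. g n x) \<longlonglongrightarrow> f x"
    by eventually_elim (rule lim)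
  then have lim: "AE x in lborel. (\<lambda>n. g n x) \<longlonglongrightarrow> f x"
    by (simp add: AE_completion_iff)
  define c where "c m = real (Suc m)" for m
  have c: "c m > 0" for m by (simp add: c_def)
  define F where "F m x = cutoff (c m) x *\<^sub>R truncate (c m) (f x)" for m x
  define h where "h m n x = cutoff (c m) x *\<^sub>R truncate (c m) (g n x)" for m n x
  \<comment> \<open>The errors are squared norms: two of size \<epsilon>/4 add up, after square
    roots, to the square root of \<epsilon>.\<close>
  have "\<forall>\<^sub>F m in sequentially. (LINT x|lborel. (norm (f x - F m x))\<^sup>2) < \<epsilon> / 4"
    using order_tendstoD(2)[OF integral_cutoff_truncate_tendsto[OF f], of "\<epsilon> / 4"] \<open>\<epsilon> > 0\<close>
    by (simp add: F_def c_def)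
  then obtain m where m: "(LINT x|lborel. (norm (f x - F m x))\<^sup>2) < \<epsilon> / 4"
    using eventually_happens' sequentially_bot by blast
  have "\<forall>\<^sub>F n in sequentially. (LINT x|lborel. (norm (F m x - h m n x))\<^sup>2) < \<epsilon> / 4"
    using order_tendstoD(2)[OF integral_truncate_approx_tendsto[OF L2_measurable[OF f] c g lim, where R = "c m"], of "\<epsilon> / 4" m] \<open>\<epsilon> > 0\<close>
    by (simp add: F_def h_def)
  then obtain n where n: "(LINT x|lborel. (norm (F m x - h m n x))\<^sup>2) < \<epsilon> / 4"
    using eventually_happens' sequentially_bot by blast
  have bound: "norm (cutoff (c m) x *\<^sub>R truncate (c m) y) \<le> 1 * c m" for x :: "real^3" and y :: 'b
    unfolding norm_scaleR
    by (intro mult_mono norm_truncate_le) (use cutoff_bounds[of "c m" x] c[of m] in auto)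
  have conth: "continuous_on UNIV (h m n)"
    unfolding h_def
    by (intro continuous_on_scaleR continuous_cutoff continuous_on_compose2[OF continuous_truncate[OF c, of UNIV] g]) auto
  have [measurable]: "truncate (c m) \<in> borel_measurable (borel :: 'b measure)"
    "cutoff (c m) \<in> borel_measurable (borel :: (real^3) measure)"
    using c by (intro borel_measurable_continuous_onI continuous_truncate continuous_cutoff; simp)+
  have "F m \<in> borel_measurable borel" unfolding F_def by measurable
  then have F: "F m \<in> L2"
    by (rule L2_bounded_support[where M = "c m" and R = "c m"])
       (use bound in \<open>auto simp: F_def cutoff_eq_0\<close>)
  have h: "h m n \<in> L2"
    by (rule L2_bounded_support[where M = "c m" and R = "c m"])
       (use bound conth in \<open>auto simp: h_def cutoff_eq_0 intro: borel_measurable_continuous_onI\<close>)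
  have "sqrt (LINT x|lborel. (norm (f x - h m n x))\<^sup>2) \<le>
      sqrt (LINT x|lborel. (norm (f x - F m x))\<^sup>2) + sqrt (LINT x|lborel. (norm (F m x - h m n x))\<^sup>2)"
    using L2_Minkowski[OF L2_diff[OF f F] L2_diff[OF F h]] by simp
  also have "\<dots> < sqrt (\<epsilon> / 4) + sqrt (\<epsilon> / 4)"
    using m n by (intro add_strict_mono) simp_all
  also have "\<dots> = sqrt \<epsilon>" by (simp add: real_sqrt_divide)
  finally have "(LINT x|lborel. (norm (f x - h m n x))\<^sup>2) < \<epsilon>" by simp
  moreover have "h m n x = 0" if "norm x \<ge> c m" for x
    using that by (simp add: h_def cutoff_eq_0)
  moreover have "norm (h m n x) \<le> c m" for x
    using bound by (simp add: h_def)
  ultimately show ?thesis using that conth h by blast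
qed

lemma dilation_tendsto_continuous:
  fixes h :: "real^3 \<Rightarrow> 'b::euclidean_space"
  assumes cont: "continuous_on UNIV h" and supp: "\<And>x. norm x \<ge> R \<Longrightarrow> h x = 0"
    and bound: "\<And>x. norm (h x) \<le> M"
    and t: "t \<longlonglongrightarrow> s" "\<And>n. t n > 0" "s > 0" and w: "w \<longlonglongrightarrow> w0"
  shows "(\<lambda>n. LINT x|lborel. (norm (w n *\<^sub>R h (t n *\<^sub>R x) - w0 *\<^sub>R h (s *\<^sub>R x)))\<^sup>2) \<longlonglongrightarrow> 0"
proof -
  have [measurable]: "h \<in> borel_measurable borel"
    using cont by (rule borel_measurable_continuous_onI)
  have "(\<lambda>n. inverse (t n)) \<longlonglongrightarrow> inverse s"
    using t by (intro tendsto_inverse) auto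
  then have "Bseq (\<lambda>n. inverse (t n))" by (intro convergent_imp_Bseq convergentI)
  then obtain B where B: "B > 0" "\<And>n. norm (inverse (t n)) \<le> B"
    by (auto simp: Bseq_def)
  obtain W where W: "W > 0" "\<And>n. norm (w n) \<le> W"
    using convergent_imp_Bseq[OF convergentI[OF w]] by (auto simp: Bseq_def)
  \<comment> \<open>If \<open>h\<close> lives in the ball of radius R, then x \<mapsto> h(a x) lives
    in the ball of radius R/a. \<open>B\<close> bounds all 1/t_n, \<open>inverse s\<close> accounts
    for the limit, and the maximum with 0 admits a negative \<open>R\<close>.\<close>
  define S where "S = max R 0 * max B (inverse s)"
  have far: "h (a *\<^sub>R x) = 0" if "norm x > S" "a > 0" "inverse a \<le> max B (inverse s)" for a x
  proof -
    have "max R 0 * inverse a \<le> S"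
      unfolding S_def using that by (intro mult_left_mono) auto
    with that have "max R 0 * inverse a < norm x" by simp
    then have "max R 0 < a * norm x" using that(2) by (simp add: field_simps)
    then show ?thesis using that(2) by (intro supp) simp
  qed
  have "(\<lambda>n. LINT x|lborel. (norm (w n *\<^sub>R h (t n *\<^sub>R x) - w0 *\<^sub>R h (s *\<^sub>R x)))\<^sup>2)
      \<longlonglongrightarrow> (LINT x|(lborel :: (real^3) measure). (0::real))"
  proof (rule integral_dominated_convergence)
    have "emeasure lborel (cball 0 S :: (real^3) set) < \<infinity>"
      by (intro emeasure_bounded_finite) auto
    then show "integrable lborel (\<lambda>x. (W * M + \<bar>w0\<bar> * M)\<^sup>2 * indicator (cball 0 S :: (real^3) set) x :: real)"
      by simp
    show "AE x in lborel. (\<lambda>n. (norm (w n *\<^sub>R h (t n *\<^sub>R x) - w0 *\<^sub>R h (s *\<^sub>R x)))\<^sup>2) \<longlonglongrightarrow> 0"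
    proof (intro AE_I2)
      fix x
      have "isCont h (s *\<^sub>R x)" using cont by (simp add: continuous_on_eq_continuous_at)
      then have "(\<lambda>n. h (t n *\<^sub>R x)) \<longlonglongrightarrow> h (s *\<^sub>R x)"
        by (rule isCont_tendsto_compose) (intro tendsto_intros t)
      then have "(\<lambda>n. (norm (w n *\<^sub>R h (t n *\<^sub>R x) - w0 *\<^sub>R h (s *\<^sub>R x)))\<^sup>2)
          \<longlonglongrightarrow> (norm (w0 *\<^sub>R h (s *\<^sub>R x) - w0 *\<^sub>R h (s *\<^sub>R x)))\<^sup>2"
        using w by (intro tendsto_intros)
      then show "(\<lambda>n. (norm (w n *\<^sub>R h (t n *\<^sub>R x) - w0 *\<^sub>R h (s *\<^sub>R x)))\<^sup>2) \<longlonglongrightarrow> 0" by simp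
    qed
    show "AE x in lborel. norm ((norm (w n *\<^sub>R h (t n *\<^sub>R x) - w0 *\<^sub>R h (s *\<^sub>R x)))\<^sup>2)
      \<le> (W * M + \<bar>w0\<bar> * M)\<^sup>2 * indicator (cball 0 S) x" for n
    proof (intro AE_I2)
      fix x
      have "norm (w n *\<^sub>R h (t n *\<^sub>R x) - w0 *\<^sub>R h (s *\<^sub>R x))
          \<le> norm (w n) * norm (h (t n *\<^sub>R x)) + \<bar>w0\<bar> * norm (h (s *\<^sub>R x))"
        using norm_triangle_ineq4[of "w n *\<^sub>R h (t n *\<^sub>R x)" "w0 *\<^sub>R h (s *\<^sub>R x)"] by simp
      also have "\<dots> \<le> W * M + \<bar>w0\<bar> * M"
        using W bound by (intro add_mono mult_mono) (auto intro: less_imp_le)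
      finally have "(norm (w n *\<^sub>R h (t n *\<^sub>R x) - w0 *\<^sub>R h (s *\<^sub>R x)))\<^sup>2 \<le> (W * M + \<bar>w0\<bar> * M)\<^sup>2"
        by (intro power_mono) auto
      moreover have "w n *\<^sub>R h (t n *\<^sub>R x) - w0 *\<^sub>R h (s *\<^sub>R x) = 0" if "norm x > S"
      proof -
        have "inverse (t n) \<le> max B (inverse s)" using B(2)[of n] t(2)[of n] by simp
        then show ?thesis
          using far[OF that t(2)[of n]] far[OF that t(3)] by simp
      qed
      ultimately show "norm ((norm (w n *\<^sub>R h (t n *\<^sub>R x) - w0 *\<^sub>R h (s *\<^sub>R x)))\<^sup>2)
        \<le> (W * M + \<bar>w0\<bar> * M)\<^sup>2 * indicator (cball 0 S) x"
        by (cases "norm x \<le> S") auto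
    qed
  qed measurable
  then show ?thesis by simp
qed

text \<open>An approximation argument: \<open>f\<close> is replaced by \<open>h\<close>, for which
  the convergence is known, and a weighted dilation changes the L^2 error only by an explicit
  factor. The weights \<open>w\<close> are free because functions and gradients carry different
  powers of t.\<close>

lemma dilation_tendsto:
  fixes f :: "real^3 \<Rightarrow> 'b::euclidean_space"
  assumes f: "f \<in> L2"
    and t: "t \<longlonglongrightarrow> s" "\<And>n. t n > 0" "s > 0" and w: "w \<longlonglongrightarrow> w0"
  shows "(\<lambda>n. LINT x|lborel. (norm (w n *\<^sub>R f (t n *\<^sub>R x) - w0 *\<^sub>R f (s *\<^sub>R x)))\<^sup>2) \<longlonglongrightarrow> 0"
    (is "?J \<longlonglongrightarrow> 0")
proof (rule order_tendstoI)
  fix \<epsilon> :: real assume "\<epsilon> < 0"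
  then show "\<forall>\<^sub>F n in sequentially. \<epsilon> < ?J n"
    by (intro always_eventually allI less_le_trans[OF _ integral_nonneg_AE]) auto
next
  fix \<epsilon> :: real assume "\<epsilon> > 0"
  \<comment> \<open>The limit of the total coefficient of the approximation error: one replacement
    for the n-th dilate and one for the limit.\<close>
  define C where "C = 2 * (\<bar>w0\<bar> / sqrt (s ^ 3))"
  have "C \<ge> 0" using t(3) by (simp add: C_def)
  \<comment> \<open>Chosen so that an L^2 error d with d^2 < \<eta> satisfies C d < sqrt \<epsilon>;
    the added 1 avoids division by 0 when \<open>w0 = 0\<close>.\<close>
  define \<eta> where "\<eta> = (sqrt \<epsilon> / (C + 1))\<^sup>2"
  have "\<eta> > 0" using \<open>\<epsilon> > 0\<close> \<open>C \<ge> 0\<close> by (simp add: \<eta>_def)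
  obtain h R M where h: "h \<in> L2" "continuous_on UNIV h" "\<And>x. norm x \<ge> R \<Longrightarrow> h x = 0"
      "\<And>x. norm (h x) \<le> M" and e: "(LINT x|lborel. (norm (f x - h x))\<^sup>2) < \<eta>"
    using L2_continuous_approx[OF f \<open>\<eta> > 0\<close>] by blast
  define d where "d = sqrt (LINT x|lborel. (norm (f x - h x))\<^sup>2)"
  have "0 \<le> d" by (simp add: d_def)
  have "d < sqrt \<eta>" using e by (simp add: d_def)
  also have "sqrt \<eta> = sqrt \<epsilon> / (C + 1)" using \<open>\<epsilon> > 0\<close> \<open>C \<ge> 0\<close> by (simp add: \<eta>_def)
  finally have "d * (C + 1) < sqrt \<epsilon>" using \<open>C \<ge> 0\<close> by (simp add: field_simps)
  then have small: "C * d < sqrt \<epsilon>" using \<open>0 \<le> d\<close> by (simp add: algebra_simps)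
  let ?H = "\<lambda>n. LINT x|lborel. (norm (w n *\<^sub>R h (t n *\<^sub>R x) - w0 *\<^sub>R h (s *\<^sub>R x)))\<^sup>2"
  have scaled: "sqrt (LINT x|lborel. (norm (v *\<^sub>R (f (a *\<^sub>R x) - h (a *\<^sub>R x))))\<^sup>2) = \<bar>v\<bar> / sqrt (a ^ 3) * d"
    if "a > 0" for v a
    using that integral_scaled3[OF that, of "\<lambda>x. (norm (f x - h x))\<^sup>2"]
    by (simp add: d_def power_mult_distrib real_sqrt_mult real_sqrt_divide)
  have le: "sqrt (?J n) \<le> \<bar>w n\<bar> / sqrt (t n ^ 3) * d + (sqrt (?H n) + \<bar>w0\<bar> / sqrt (s ^ 3) * d)" for n
  proof -
    let ?a = "\<lambda>x. w n *\<^sub>R (f (t n *\<^sub>R x) - h (t n *\<^sub>R x))"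
    let ?b = "\<lambda>x. w n *\<^sub>R h (t n *\<^sub>R x) - w0 *\<^sub>R h (s *\<^sub>R x)"
    let ?c = "\<lambda>x. (- w0) *\<^sub>R (f (s *\<^sub>R x) - h (s *\<^sub>R x))"
    have a: "?a \<in> L2" using L2_scaled[OF L2_diff[OF f h(1)] t(2)[of n], of "w n"] by simp
    have b: "?b \<in> L2" using t by (intro L2_diff L2_scaled h)
    have c: "?c \<in> L2" using L2_scaled[OF L2_diff[OF f h(1)] t(3), of "- w0"] by simp
    have "?J n = (LINT x|lborel. (norm (?a x + (?b x + ?c x)))\<^sup>2)"
      by (simp add: algebra_simps)
    then have "sqrt (?J n) \<le> sqrt (LINT x|lborel. (norm (?a x))\<^sup>2) + sqrt (LINT x|lborel. (norm (?b x + ?c x))\<^sup>2)"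
      using L2_Minkowski[OF a L2_add[OF b c]] by simp
    also have "\<dots> \<le> sqrt (LINT x|lborel. (norm (?a x))\<^sup>2) + (sqrt (?H n) + sqrt (LINT x|lborel. (norm (?c x))\<^sup>2))"
      using L2_Minkowski[OF b c] by simp
    also have "\<dots> = \<bar>w n\<bar> / sqrt (t n ^ 3) * d + (sqrt (?H n) + \<bar>w0\<bar> / sqrt (s ^ 3) * d)"
      unfolding scaled[OF t(2)] scaled[OF t(3)] by simp
    finally show ?thesis .
  qed
  have "(\<lambda>n. \<bar>w n\<bar> / sqrt (t n ^ 3) * d + (sqrt (?H n) + \<bar>w0\<bar> / sqrt (s ^ 3) * d))
      \<longlonglongrightarrow> \<bar>w0\<bar> / sqrt (s ^ 3) * d + (sqrt 0 + \<bar>w0\<bar> / sqrt (s ^ 3) * d)"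
    using t(3) by (intro tendsto_intros t(1) w dilation_tendsto_continuous[OF h(2,3,4) t w]) auto
  then have "\<forall>\<^sub>F n in sequentially.
      \<bar>w n\<bar> / sqrt (t n ^ 3) * d + (sqrt (?H n) + \<bar>w0\<bar> / sqrt (s ^ 3) * d) < sqrt \<epsilon>"
    by (rule order_tendstoD(2)) (use small in \<open>simp add: C_def mult_ac\<close>)
  then show "\<forall>\<^sub>F n in sequentially. ?J n < \<epsilon>"
  proof eventually_elim
    case (elim n)
    with le[of n] have "sqrt (?J n) < sqrt \<epsilon>" by linarith
    then show ?case by simp
  qed
qed

text \<open>\<open>dilation_tendsto\<close> is used twice: with weight t^(3/2) for the function and
  t^(5/2) for its gradient. Sequences are used because it rests on dominated convergence.\<close>

lemma H1_continuous_on_dilate: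
  assumes u: "u \<in> H1" and cont: "continuous_on I \<tau>" and pos: "\<And>t. t \<in> I \<Longrightarrow> \<tau> t > 0"
  shows "H1_continuous_on I (\<lambda>t. dilate (\<tau> t) u)"
  unfolding H1_continuous_on_def
proof (intro conjI ballI)
  show "dilate (\<tau> t) u \<in> H1" if "t \<in> I" for t
    using u pos[OF that] by (rule H1_dilate)
  fix s assume s: "s \<in> I"
  show "((\<lambda>t. H1_dist (dilate (\<tau> t) u) (dilate (\<tau> s) u)) \<longlongrightarrow> 0) (at s within I)"
    unfolding tendsto_at_iff_sequentially comp_def
  proof (intro allI impI)
    fix X assume X: "\<forall>i::nat. X i \<in> I - {s}" "X \<longlonglongrightarrow> s"
    have lim: "(\<lambda>i. \<tau> (X i)) \<longlonglongrightarrow> \<tau> s"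
      using cont s X unfolding continuous_on_sequentially comp_def by blast
    have posX: "\<tau> (X i) > 0" for i using X(1) pos by auto
    have sq: "(\<lambda>i. sqrt (\<tau> (X i) ^ 3)) \<longlonglongrightarrow> sqrt (\<tau> s ^ 3)"
      by (intro tendsto_intros lim)
    have "(\<lambda>i. mass (\<lambda>x. dilate (\<tau> (X i)) u x - dilate (\<tau> s) u x)) \<longlonglongrightarrow> 0"
      using dilation_tendsto[OF H1_grad(1)[OF u] lim posX pos[OF s] sq]
      by (simp add: mass_def dilate_def)
    moreover have "(\<lambda>i. kinetic (\<lambda>x. dilate (\<tau> (X i)) u x - dilate (\<tau> s) u x)) \<longlonglongrightarrow> 0"
      using dilation_tendsto[OF H1_grad(2)[OF u] lim posX pos[OF s] tendsto_mult[OF lim sq]]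
      unfolding kinetic_dilate_diff[OF u pos[OF s] posX] by (simp add: dilate_def)
    ultimately have "(\<lambda>i. sqrt (mass (\<lambda>x. dilate (\<tau> (X i)) u x - dilate (\<tau> s) u x)
        + kinetic (\<lambda>x. dilate (\<tau> (X i)) u x - dilate (\<tau> s) u x))) \<longlonglongrightarrow> sqrt (0 + 0)"
      by (intro tendsto_intros)
    then show "(\<lambda>i. H1_dist (dilate (\<tau> (X i)) u) (dilate (\<tau> s) u)) \<longlonglongrightarrow> 0"
      by (simp add: H1_dist_def)
  qed
qed

section \<open>The mountain pass level and global existence\<close>

lemma virial_eq: "virial lam1 lam2 u = 3 * energy lam1 lam2 u - kinetic u / 2"
  by (simp add: virial_def energy_def algebra_simps)

text \<open>When B = -2A/3, the left side is the energy of the dilate divided by A, and 1/6 is its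
  value at t = 1. The critical point there appears as a double root of the difference.\<close>

lemma dilation_energy_bound:
  fixes t :: real
  assumes "t \<ge> 0"
  shows "t\<^sup>2 / 2 - t ^ 3 / 3 \<le> 1 / 6"
proof -
  have "1 / 6 - (t\<^sup>2 / 2 - t ^ 3 / 3) = (t - 1)\<^sup>2 * (2 * t + 1) / 6"
    by (simp add: power2_eq_square power3_eq_cube algebra_simps)
  also have "\<dots> \<ge> 0" using assms by simp
  finally show ?thesis by simp
qed

lemma mp_level_le_energy:
  assumes v: "v \<in> H1" and k: "k > 0" and Q: "virial lam1 lam2 v = 0" and K: "kinetic v > 0"
  shows "mp_level lam1 lam2 k (mass v) \<le> ereal (energy lam1 lam2 v)"
proof -
  \<comment> \<open>The dilate by \<open>a\<close> has kinetic energy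
    \<open>a\<^sup>2 * kinetic v = k\<close>, just small enough for a starting point.\<close>
  define a where "a = sqrt (k / kinetic v)"
  \<comment> \<open>At t = 2 the energy is A(2 - 8/3) < 0. If \<open>a\<close> exceeds 1 the path
    need not pass through \<open>v\<close>, but the energy bound holds for every dilate.\<close>
  define \<tau> where "\<tau> s = (1 - s) * a + s * 2" for s :: real
  define g where "g s = dilate (\<tau> s) v" for s
  have "a > 0" using k K by (simp add: a_def)
  have \<tau>: "\<tau> s > 0" if "s \<in> {0..1}" for s
    using that \<open>a > 0\<close> unfolding \<tau>_def
    by (cases "s = 0") (auto intro!: add_nonneg_pos)
  have B: "interaction lam1 lam2 v = - 2 / 3 * kinetic v"
    using Q by (simp add: virial_def)
  have E: "energy lam1 lam2 v = kinetic v * (1 / 6)"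
    by (simp add: energy_def B)
  have Eg: "energy lam1 lam2 (g s) = kinetic v * ((\<tau> s)\<^sup>2 / 2 - (\<tau> s) ^ 3 / 3)" if "s \<in> {0..1}" for s
    unfolding g_def by (simp add: energy_dilate[OF v \<tau>[OF that]] B algebra_simps)
  have "g \<in> mp_paths lam1 lam2 k (mass v)"
    unfolding mp_paths_def
  proof (intro CollectI conjI ballI)
    show "H1_continuous_on {0..1} g"
      unfolding g_def using v \<tau> by (intro H1_continuous_on_dilate) (auto simp: \<tau>_def intro!: continuous_intros)
    show "g t \<in> mass_sphere (mass v)" if "t \<in> {0..1}" for t
      using H1_dilate[OF v \<tau>[OF that]] mass_dilate[OF \<tau>[OF that]] by (simp add: mass_sphere_def g_def)
    show "kinetic (g 0) \<le> k"
      using kinetic_dilate[OF v \<open>a > 0\<close>] k K by (simp add: g_def \<tau>_def a_def)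
    show "energy lam1 lam2 (g 1) < 0"
      using Eg[of 1] K by (simp add: \<tau>_def)
  qed
  then have "mp_level lam1 lam2 k (mass v) \<le> (SUP t\<in>{0..1}. ereal (energy lam1 lam2 (g t)))"
    unfolding mp_level_def by (rule INF_lower)
  also have "\<dots> \<le> ereal (energy lam1 lam2 v)"
  proof (rule SUP_least)
    fix s :: real assume s: "s \<in> {0..1}"
    show "ereal (energy lam1 lam2 (g s)) \<le> ereal (energy lam1 lam2 v)"
      unfolding Eg[OF s] E using K dilation_energy_bound[of "\<tau> s"] \<tau>[OF s] by simp
  qed
  finally show ?thesis .
qed

text \<open>Blow-up provides a time before \<open>r\<close> at which \<open>kinetic\<close> is at
  least \<open>y\<close>; continuity on the compact interval up to that time gives the value
  itself.\<close>

lemma kinetic_attains_between: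
  assumes cont: "H1_continuous_on {0..<r} \<psi>" and "r > 0"
    and blowup: "filterlim (\<lambda>t. sqrt (kinetic (\<psi> t))) at_top (at_left r)"
    and y: "kinetic (\<psi> 0) \<le> y"
  shows "\<exists>t\<in>{0..<r}. kinetic (\<psi> t) = y"
proof -
  have "\<forall>\<^sub>F t in at_left r. sqrt y \<le> sqrt (kinetic (\<psi> t))"
    using blowup unfolding filterlim_at_top by blast
  moreover have "\<forall>\<^sub>F t in at_left r. t \<in> {0<..<r}"
    using \<open>r > 0\<close> by (rule eventually_at_left_real)
  ultimately have "\<forall>\<^sub>F t in at_left r. sqrt y \<le> sqrt (kinetic (\<psi> t)) \<and> t \<in> {0<..<r}"
    by (rule eventually_conj)
  then obtain t where t: "sqrt y \<le> sqrt (kinetic (\<psi> t))" "t \<in> {0<..<r}"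
    using eventually_happens'[OF trivial_limit_at_left_real] by blast
  have "continuous_on {0..t} (\<lambda>t. kinetic (\<psi> t))"
    by (rule continuous_on_subset[OF continuous_on_kinetic[OF cont]]) (use t(2) in auto)
  then obtain x where "0 \<le> x" "x \<le> t" "kinetic (\<psi> x) = y"
    using IVT'[of "\<lambda>t. kinetic (\<psi> t)" 0 y t] y t by auto
  then show ?thesis using t(2) by auto
qed

theorem theorem1p3:
  fixes lam1 lam2 c k :: real and u0 :: "real^3 \<Rightarrow> complex"
  assumes "local_theory lam1 lam2"
    and "unstable_regime lam1 lam2"
    and "u0 \<in> H1"
    and "c = mass u0"
    and "k > 0"
    and "mp_geometry lam1 lam2 k c"
    and "virial lam1 lam2 u0 > 0"
    and "ereal (energy lam1 lam2 u0) < mp_level lam1 lam2 k c"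
  shows "(\<exists>\<psi>. maximal_solution lam1 lam2 u0 \<infinity> \<psi>) \<and>
    (\<forall>T \<psi>. maximal_solution lam1 lam2 u0 T \<psi> \<longrightarrow> T = \<infinity>)"
proof -
  obtain T \<psi> where max: "maximal_solution lam1 lam2 u0 T \<psi>"
    and unique: "\<And>T' \<psi>'. maximal_solution lam1 lam2 u0 T' \<psi>' \<Longrightarrow> T' = T"
    and conserved: "\<And>t. t \<in> time_interval T \<Longrightarrow> mass (\<psi> t) = mass u0 \<and> energy lam1 lam2 (\<psi> t) = energy lam1 lam2 u0"
    and alternative: "T = \<infinity> \<or> filterlim (\<lambda>t. sqrt (kinetic (\<psi> t))) at_top (at_left (real_of_ereal T))"
    using assms(1,3) unfolding local_theory_def by blast
  from max have "T > 0" and cont: "H1_continuous_on (time_interval T) \<psi>"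
    and init: "AE x in lborel. \<psi> 0 x = u0 x"
    by (auto simp: maximal_solution_def solution_on_def)
  have "T = \<infinity>"
  proof (rule ccontr)
    assume "T \<noteq> \<infinity>"
    with \<open>T > 0\<close> obtain r where r: "T = ereal r" "r > 0" by (cases T) auto
    have interval: "time_interval T = {0..<r}" by (auto simp: time_interval_def r)
    define E where "E = energy lam1 lam2 u0"
    note cont = cont[unfolded interval]
    have H1: "\<psi> t \<in> H1" if "t \<in> {0..<r}" for t
      using cont that by (simp add: H1_continuous_on_def)
    \<comment> \<open>The initial condition holds only almost everywhere, so the equality passes
      through \<open>kinetic_cong_AE\<close>.\<close>
    have "kinetic (\<psi> 0) = kinetic u0"
      using init H1[of 0] r(2) assms(3) by (intro kinetic_cong_AE H1_grad(1)) auto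
    then have less: "kinetic (\<psi> 0) < 6 * E"
      using assms(7) by (simp add: virial_eq E_def)
    \<comment> \<open>With the energy conserved, 6E is exactly the value of \<open>kinetic\<close>
      at which \<open>virial\<close> vanishes.\<close>
    then obtain t where t: "t \<in> {0..<r}" "kinetic (\<psi> t) = 6 * E"
      using kinetic_attains_between[OF cont r(2), of "6 * E"] alternative r(1) by auto
    have "mass (\<psi> t) = c" "energy lam1 lam2 (\<psi> t) = E"
      using conserved[of t] t(1) assms(4) by (auto simp: interval E_def)
    \<comment> \<open>Strictness comes from Q > 0 at time 0: the level 6E lies strictly above the
      nonnegative initial kinetic energy.\<close>
    moreover have "kinetic (\<psi> t) > 0"
      using less kinetic_nonneg[of "\<psi> 0"] t(2) by linarith
    moreover have "virial lam1 lam2 (\<psi> t) = 0"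
      using t(2) \<open>energy lam1 lam2 (\<psi> t) = E\<close> by (simp add: virial_eq)
    ultimately have "mp_level lam1 lam2 k c \<le> ereal E"
      using mp_level_le_energy[OF H1[OF t(1)] assms(5)] by metis
    with assms(8) show False by (simp add: E_def)
  qed
  with max unique show ?thesis by blast
qed

end
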